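(* Let $\alpha,\beta\in\mathbb{R}$ and $0<p<\infty$. Suppose that $\min\{\alpha,\beta\}\le\max\{-\frac12,-\frac1p\}$. Then there are functions $\psi\in\mathfrak{B}_p^{1/p+\alpha+\beta}$ such that the weighted integral Hankel operator $\boldsymbol{\Gamma}^{\alpha,\beta}_\psi$ on $L^2(\mathbb{R}_+)$ does not belong to the Schatten--von Neumann class $\boldsymbol{S}_p$.
   Context: $\mathbb{R}_+=(0,\infty)$. For a bounded operator $T$ on a Hilbert space $\mathcal{H}$, $s_j(T)=\inf\{\|T-K\|:\ \operatorname{rank}K\le j\}$, $j\ge0$, and $\boldsymbol{S}_p$ ($0<p<\infty$) is the set of $T$ with $\|T\|_{\boldsymbol{S}_p}=\big(\sum_{j\ge0}s_j(T)^p\big)^{1/p}<\infty$. Weighted integral Hankel operators: for a locally integrable function (or, more generally, a distribution) $\varphi$ on $(0,\infty)$ and $\alpha,\beta\in\mathbb{R}$, the operator $\boldsymbol{\Gamma}^{\alpha,\beta}_\varphi$ is defined on smooth functions $f$ with compact support in $(0,\infty)$ by $$(\boldsymbol{\Gamma}^{\alpha,\beta}_\varphi f)(x)=\int_0^\infty x^\alpha y^\beta\varphi(x+y)f(y)\,dy,\quad x>0,$$ the integral being understood in the sense of distributions when $\varphi$ is a distribution. It is said to be bounded on $L^2(\mathbb{R}_+)$ if it extends by continuity to $L^2(\mathbb{R}_+)$, and to belong to $\boldsymbol{S}_p$ if it is bounded and the extension belongs to $\boldsymbol{S}_p$. Besov classes on $\mathbb{R}_+$: fix a $C^\infty$ function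 $v$ on $\mathbb{R}$ with $\operatorname{supp}v=[\frac12,2]$ and $\sum_{j=-\infty}^\infty v(x/2^j)=1$ for $x>0$, and put $v_j(x)=v(x/2^j)$. Let $\mathcal{F}$ denote the Fourier transform. For $0<p<\infty$ and $s\in\mathbb{R}$, $\mathfrak{B}_p^s$ is the space of distributions $\varphi$ on $(0,\infty)$ such that $$\|\varphi\|_{\mathfrak{B}_p^s}=\Big(\sum_{j=-\infty}^\infty\big(2^{js}\|\mathcal{F}(v_j\varphi)\|_{L^p(\mathbb{R})}\big)^p\Big)^{1/p}<\infty.$$ *)

theory Defs
  imports "HOL-Analysis.Analysis"
begin

definition vderiv :: "(real \<Rightarrow> complex) \<Rightarrow> real \<Rightarrow> complex" where
  "vderiv f = (\<lambda>x. vector_derivative f (at x))"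

definition smooth :: "(real \<Rightarrow> complex) \<Rightarrow> bool" where
  "smooth f \<longleftrightarrow> (\<forall>n x. (vderiv ^^ n) f differentiable at x)"

definition supp :: "(real \<Rightarrow> complex) \<Rightarrow> real set" where
  "supp f = closure {x. f x \<noteq> 0}"

definition test_functions :: "(real \<Rightarrow> complex) set" where
  "test_functions = {f. smooth f \<and> compact (supp f) \<and> supp f \<subseteq> {0<..}}"

text \<open>
  A distribution on the half-line is represented by a functional on all functions of a real
  variable, of which only the values on test functions are meaningful.  Continuity is the usual
  seminorm estimate on each compact set.
\<close>

definition distribution :: "((real \<Rightarrow> complex) \<Rightarrow> complex) \<Rightarrow> bool" where
  "distribution \<phi> \<longleftrightarrow>
     (\<forall>f\<in>test_functions. \<forall>g\<in>test_functions. \<phi> (\<lambda>x. f x + g x) = \<phi> f + \<phi> g) \<and>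
     (\<forall>c. \<forall>f\<in>test_functions. \<phi> (\<lambda>x. c * f x) = c * \<phi> f) \<and>
     (\<forall>K. compact K \<and> K \<subseteq> {0<..} \<longrightarrow>
        (\<exists>C m. \<forall>f\<in>test_functions. supp f \<subseteq> K \<longrightarrow>
           norm (\<phi> f) \<le> C * (\<Sum>k\<le>m. SUP x. norm ((vderiv ^^ k) f x))))"

definition locally_integrable :: "(real \<Rightarrow> complex) \<Rightarrow> bool" where
  "locally_integrable \<psi> \<longleftrightarrow>
     (\<forall>K. compact K \<and> K \<subseteq> {0<..} \<longrightarrow> set_integrable lborel K \<psi>)"

definition regular_dist :: "(real \<Rightarrow> complex) \<Rightarrow> (real \<Rightarrow> complex) \<Rightarrow> complex" where
  "regular_dist \<psi> f = (LBINT x:{0<..}. \<psi> x * f x)"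

definition dyadic_cutoff :: "(real \<Rightarrow> complex) \<Rightarrow> bool" where
  "dyadic_cutoff v \<longleftrightarrow> smooth v \<and> supp v = {1/2..2} \<and>
     (\<forall>x>0. ((\<lambda>j::int. v (x / 2 powi j)) has_sum 1) UNIV)"

definition dist_mult ::
    "(real \<Rightarrow> complex) \<Rightarrow> ((real \<Rightarrow> complex) \<Rightarrow> complex) \<Rightarrow> (real \<Rightarrow> complex) \<Rightarrow> complex" where
  "dist_mult h \<phi> = (\<lambda>f. \<phi> (\<lambda>x. h x * f x))"

text \<open>
  The Fourier transform of a compactly supported distribution \<open>u\<close> is the smooth function obtained
  by applying \<open>u\<close> to the exponentials.  It is only used for \<open>u = dist_mult h \<phi>\<close> with a test
  function \<open>h\<close>, which is defined on every smooth function on the line.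
\<close>

definition fourier_dist :: "((real \<Rightarrow> complex) \<Rightarrow> complex) \<Rightarrow> real \<Rightarrow> complex" where
  "fourier_dist u \<xi> = u (\<lambda>x. exp (- (\<i> * of_real x * of_real \<xi>)))"

definition in_Lp :: "real \<Rightarrow> (real \<Rightarrow> complex) \<Rightarrow> bool" where
  "in_Lp p g \<longleftrightarrow> g \<in> borel_measurable lborel \<and> integrable lborel (\<lambda>x. norm (g x) powr p)"

definition Lp_norm :: "real \<Rightarrow> (real \<Rightarrow> complex) \<Rightarrow> real" where
  "Lp_norm p g = (LBINT x. norm (g x) powr p) powr (1 / p)"

definition besov_block ::
    "(real \<Rightarrow> complex) \<Rightarrow> int \<Rightarrow> ((real \<Rightarrow> complex) \<Rightarrow> complex) \<Rightarrow> real \<Rightarrow> complex" where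
  "besov_block v j \<phi> = fourier_dist (dist_mult (\<lambda>x. v (x / 2 powi j)) \<phi>)"

text \<open>
  Since the Bochner integral and real sums have default values, finiteness of the Besov norm is
  spelled out as finiteness of each block norm together with summability.
\<close>

definition besov_class ::
    "(real \<Rightarrow> complex) \<Rightarrow> real \<Rightarrow> real \<Rightarrow> ((real \<Rightarrow> complex) \<Rightarrow> complex) set" where
  "besov_class v p s = {\<phi>. distribution \<phi> \<and>
     (\<forall>j::int. in_Lp p (besov_block v j \<phi>)) \<and>
     (\<lambda>j::int. (2 powr (of_int j * s) * Lp_norm p (besov_block v j \<phi>)) powr p) summable_on UNIV}"

text \<open>
  Elements of \<open>L\<^sup>2\<close> are represented by functions, and operators act on representatives.  Linearity
  is required almost everywhere; with boundedness it implies that almost equal functions have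
  almost equal images, so that the operator descends to equivalence classes.
\<close>

abbreviation Rplus :: "real measure" where
  "Rplus \<equiv> restrict_space lborel {0<..}"

definition L2 :: "(real \<Rightarrow> complex) set" where
  "L2 = {f. f \<in> borel_measurable Rplus \<and> integrable Rplus (\<lambda>x. (norm (f x))\<^sup>2)}"

definition L2_norm :: "(real \<Rightarrow> complex) \<Rightarrow> real" where
  "L2_norm f = sqrt (LINT x|Rplus. (norm (f x))\<^sup>2)"

definition bounded_op :: "((real \<Rightarrow> complex) \<Rightarrow> real \<Rightarrow> complex) \<Rightarrow> bool" where
  "bounded_op T \<longleftrightarrow>
     (\<forall>f\<in>L2. T f \<in> L2) \<and>
     (\<forall>f\<in>L2. \<forall>g\<in>L2. AE x in Rplus. T (\<lambda>y. f y + g y) x = T f x + T g x) \<and>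
     (\<forall>c. \<forall>f\<in>L2. AE x in Rplus. T (\<lambda>y. c * f y) x = c * T f x) \<and>
     (\<exists>C. \<forall>f\<in>L2. L2_norm (T f) \<le> C * L2_norm f)"

definition op_norm :: "((real \<Rightarrow> complex) \<Rightarrow> real \<Rightarrow> complex) \<Rightarrow> real" where
  "op_norm T = (SUP f\<in>{f\<in>L2. L2_norm f \<le> 1}. L2_norm (T f))"

definition rank_le :: "((real \<Rightarrow> complex) \<Rightarrow> real \<Rightarrow> complex) \<Rightarrow> nat \<Rightarrow> bool" where
  "rank_le K j \<longleftrightarrow> (\<exists>B. finite B \<and> card B \<le> j \<and> B \<subseteq> L2 \<and>
     (\<forall>f\<in>L2. \<exists>c. AE x in Rplus. K f x = (\<Sum>g\<in>B. c g * g x)))"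

definition sing_val :: "((real \<Rightarrow> complex) \<Rightarrow> real \<Rightarrow> complex) \<Rightarrow> nat \<Rightarrow> real" where
  "sing_val T j = (INF K\<in>{K. bounded_op K \<and> rank_le K j}. op_norm (\<lambda>f x. T f x - K f x))"

definition schatten :: "real \<Rightarrow> ((real \<Rightarrow> complex) \<Rightarrow> real \<Rightarrow> complex) set" where
  "schatten p = {T. bounded_op T \<and> summable (\<lambda>j. sing_val T j powr p)}"

text \<open>
  For fixed \<open>x > 0\<close> the integral of \<open>x\<^sup>\<alpha> y\<^sup>\<beta> \<phi>(x + y) f(y)\<close> over \<open>y > 0\<close> is, after the substitution
  \<open>t = x + y\<close>, the pairing of \<open>\<phi>\<close> with the test function below (which vanishes for \<open>t\<close> near and
  below \<open>x\<close>, because \<open>f\<close> is supported in the open half-line).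
\<close>

definition hankel ::
    "real \<Rightarrow> real \<Rightarrow> ((real \<Rightarrow> complex) \<Rightarrow> complex) \<Rightarrow> (real \<Rightarrow> complex) \<Rightarrow> real \<Rightarrow> complex" where
  "hankel \<alpha> \<beta> \<phi> f x =
     of_real (x powr \<alpha>) * \<phi> (\<lambda>t. of_real ((t - x) powr \<beta>) * f (t - x))"

text \<open>
  The operator, given on test functions, belongs to the Schatten class if it has an extension to
  a bounded operator on \<open>L\<^sup>2\<close> in that class; the extension is unique since test functions are dense.
\<close>

definition hankel_in_schatten ::
    "real \<Rightarrow> real \<Rightarrow> ((real \<Rightarrow> complex) \<Rightarrow> complex) \<Rightarrow> real \<Rightarrow> bool" where
  "hankel_in_schatten \<alpha> \<beta> \<phi> p \<longleftrightarrow>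
     (\<exists>T. bounded_op T \<and> (\<forall>f\<in>test_functions. AE x in Rplus. T f x = hankel \<alpha> \<beta> \<phi> f x) \<and>
          T \<in> schatten p)"

lemma test_function_eq_0: "f \<in> test_functions \<Longrightarrow> x \<le> 0 \<Longrightarrow> f x = 0"
  using closure_subset[of "{x. f x \<noteq> 0}"] by (force simp: test_functions_def supp_def)

lemma hankel_regular_dist:
  assumes f: "f \<in> test_functions" and x: "x > 0"
  shows "hankel \<alpha> \<beta> (regular_dist \<psi>) f x =
    (LBINT y:{0<..}. of_real (x powr \<alpha> * y powr \<beta>) * \<psi> (x + y) * f y)"
proof -
  have "regular_dist \<psi> (\<lambda>t. of_real ((t - x) powr \<beta>) * f (t - x)) =
      (LBINT t. indicator {0<..} t *\<^sub>R (\<psi> t * (of_real ((t - x) powr \<beta>) * f (t - x))))"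
    by (simp add: regular_dist_def set_lebesgue_integral_def)
  also have "\<dots> = (LBINT y. indicator {0<..} (x + y) *\<^sub>R (\<psi> (x + y) * (of_real (y powr \<beta>) * f y)))"
    by (subst lborel_integral_real_affine[where c = 1 and t = x]) auto
  also have "\<dots> = (LBINT y. indicator {0<..} y *\<^sub>R (\<psi> (x + y) * (of_real (y powr \<beta>) * f y)))"
    using x test_function_eq_0[OF f]
    by (intro Bochner_Integration.integral_cong) (auto simp: indicator_def not_less)
  finally show ?thesis
    unfolding hankel_def set_lebesgue_integral_def
    by (simp flip: integral_mult_right_zero) (simp add: mult_ac)
qed

lemma regular_dist_integrable:
  assumes \<psi>: "locally_integrable \<psi>" and K: "compact K" "K \<subseteq> {0<..}"
    and f: "smooth f" "supp f \<subseteq> K"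
  shows "set_integrable lborel {0<..} (\<lambda>x. \<psi> x * f x)"
    and "norm (regular_dist \<psi> f) \<le> (LBINT x:K. norm (\<psi> x)) * (SUP x. norm (f x))"
proof -
  have int: "set_integrable lborel K \<psi>"
    using \<psi> K by (auto simp: locally_integrable_def)
  have cont: "continuous_on UNIV f"
    using f(1) unfolding smooth_def
    by (auto intro!: continuous_at_imp_continuous_on differentiable_imp_continuous_within
        dest: spec[of _ 0])
  have zero: "f x = 0" if "x \<notin> K" for x
    using that f(2) closure_subset[of "{x. f x \<noteq> 0}"] by (auto simp: supp_def)
  have "bounded (f ` K)"
    by (intro compact_imp_bounded compact_continuous_image K continuous_on_subset[OF cont]) auto
  then obtain B where B: "\<And>x. x \<in> K \<Longrightarrow> norm (f x) \<le> B"
    by (auto simp: bounded_iff)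
  have "norm (f x) \<le> max B 0" for x
    using B[of x] zero[of x] by (cases "x \<in> K") auto
  then have bdd: "bdd_above (range (\<lambda>x. norm (f x)))"
    by (auto intro!: bdd_aboveI)
  define S where "S = (SUP x. norm (f x))"
  have S: "norm (f x) \<le> S" for x
    unfolding S_def by (rule cSUP_upper[OF _ bdd]) simp
  have eq: "indicator {0<..} x *\<^sub>R (\<psi> x * f x) = (indicator K x *\<^sub>R \<psi> x) * f x" for x
    using zero[of x] K(2) by (auto simp: indicator_def)
  have bnd: "norm ((indicator K x *\<^sub>R \<psi> x) * f x) \<le> (indicator K x *\<^sub>R norm (\<psi> x)) * S" for x
    using S[of x] by (auto simp: norm_mult indicator_def intro!: mult_left_mono)
  have intn: "integrable lborel (\<lambda>x. (indicator K x *\<^sub>R norm (\<psi> x)) * S)"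
    using set_integrable_norm[OF int] by (simp add: set_integrable_def)
  have f_meas: "f \<in> borel_measurable lborel"
    using borel_measurable_continuous_onI[OF cont] by simp
  have \<psi>_meas: "(\<lambda>x. indicator K x *\<^sub>R \<psi> x) \<in> borel_measurable lborel"
    using int by (auto simp: set_integrable_def)
  have *: "integrable lborel (\<lambda>x. (indicator K x *\<^sub>R \<psi> x) * f x)"
    by (rule Bochner_Integration.integrable_bound[OF intn borel_measurable_times[OF \<psi>_meas f_meas]])
      (use bnd in \<open>auto intro!: AE_I2 order.trans[OF _ abs_ge_self]\<close>)
  then show "set_integrable lborel {0<..} (\<lambda>x. \<psi> x * f x)"
    unfolding set_integrable_def eq .
  have "norm (regular_dist \<psi> f) = norm (LBINT x. (indicator K x *\<^sub>R \<psi> x) * f x)"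
    unfolding regular_dist_def set_lebesgue_integral_def eq ..
  also have "\<dots> \<le> (LBINT x. norm ((indicator K x *\<^sub>R \<psi> x) * f x))"
    by (rule integral_norm_bound)
  also have "\<dots> \<le> (LBINT x. (indicator K x *\<^sub>R norm (\<psi> x)) * S)"
    by (rule integral_mono[OF integrable_norm[OF *] intn bnd])
  also have "\<dots> = (LBINT x:K. norm (\<psi> x)) * S"
    by (simp add: set_lebesgue_integral_def)
  finally show "norm (regular_dist \<psi> f) \<le> (LBINT x:K. norm (\<psi> x)) * (SUP x. norm (f x))"
    by (simp add: S_def)
qed

lemma distribution_regular_dist:
  assumes "locally_integrable \<psi>"
  shows "distribution (regular_dist \<psi>)"
  unfolding distribution_def
proof (intro conjI ballI allI impI)
  fix f g assume fg: "f \<in> test_functions" "g \<in> test_functions"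
  have "set_integrable lborel {0<..} (\<lambda>x. \<psi> x * f x)" "set_integrable lborel {0<..} (\<lambda>x. \<psi> x * g x)"
    using fg regular_dist_integrable(1)[OF assms] by (auto simp: test_functions_def)
  then show "regular_dist \<psi> (\<lambda>x. f x + g x) = regular_dist \<psi> f + regular_dist \<psi> g"
    by (simp add: regular_dist_def distrib_left set_integral_add)
next
  fix c f
  show "regular_dist \<psi> (\<lambda>x. c * f x) = c * regular_dist \<psi> f"
    by (simp add: regular_dist_def mult.left_commute[of _ c])
next
  fix K :: "real set" assume K: "compact K \<and> K \<subseteq> {0<..}"
  show "\<exists>C m. \<forall>f\<in>test_functions. supp f \<subseteq> K \<longrightarrow>
      norm (regular_dist \<psi> f) \<le> C * (\<Sum>k\<le>m. SUP x. norm ((vderiv ^^ k) f x))"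
    by (rule exI[of _ "LBINT x:K. norm (\<psi> x)"], rule exI[of _ 0])
      (use K regular_dist_integrable(2)[OF assms] in \<open>auto simp: test_functions_def\<close>)
qed

end

theory Submission
  imports Defs "HOL-Probability.Sinc_Integral"
begin

text \<open>
  The operator is not small because of what the weights do at the boundary of the half-line. The kernel
  \<open>x\<^sup>\<alpha> y\<^sup>\<beta> \<psi>(x + y)\<close> is singular near \<open>x = 0\<close> (if \<open>\<alpha>\<close> is the smaller exponent) or near \<open>y = 0\<close> (if
  \<open>\<beta>\<close> is) even for a symbol \<open>\<psi>\<close> supported around \<open>1\<close>, and the Besov norm, which depends on \<open>\<psi>\<close> as a
  function of \<open>t = x + y\<close>, does not see this. All symbols are built from one nonnegative bump,
  obtained by rescaling \<open>\<bar>v\<bar>\<^sup>2\<close> for the given cutoff \<open>v\<close>.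

  If \<open>p \<le> 2\<close>, the smaller exponent is at most \<open>-1/2\<close>, and a single smooth bump around \<open>1\<close> is a
  counterexample for which the operator is not even bounded. For \<open>\<alpha> \<le> -1/2\<close> the image of one bump is at
  least \<open>c x\<^sup>\<alpha>\<close> near \<open>0\<close>, hence not square integrable (\<open>wide_bump_unbounded_left\<close>). For \<open>\<beta> \<le> -1/2\<close>
  the functional \<open>f \<mapsto> \<integral> y\<^sup>\<beta> f(y) dy\<close> is unbounded: a sum of \<open>N\<close> normalised bumps at the scales
  \<open>4\<^sup>-\<^sup>n\<close> has norm of order \<open>sqrt N\<close> and an image of norm at least of order \<open>N\<close> (\<open>wide_bump_unbounded_right\<close>).

  If \<open>p > 2\<close>, the smaller exponent \<open>\<gamma>\<close> satisfies \<open>\<gamma> p \<le> -1\<close>. Consider a bump of height \<open>a\<close>, width \<open>w\<close>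
  and centre \<open>c\<close> as symbol. It essentially acts as \<open>a w\<close> times the weighted reflection
  \<open>f \<mapsto> x\<^sup>\<alpha> (c - x)\<^sup>\<beta> f(c - x)\<close>, blurred at the scale \<open>w\<close>. Test functions that are bumps of width \<open>w\<close> at
  distances \<open>i w\<close> (up to a constant) from the singular boundary therefore have images concentrated on
  disjoint intervals, and the \<open>j\<close>-th singular value is at least of order \<open>a w (w j)\<^sup>\<gamma>\<close> for \<open>j\<close> up to about \<open>c/w\<close>
  (\<open>sing_val_narrow_ge\<close>). The \<open>p\<close>-th powers sum to at least \<open>a\<^sup>p w\<^sup>p\<^sup>-\<^sup>1\<close> times a harmonic sum
  \<open>\<Sum> 1/j\<close> (for \<open>c = 1\<close>), whereas the \<open>p\<close>-th power of the Besov norm of the bump is at most of order \<open>a\<^sup>p w\<^sup>p\<^sup>-\<^sup>1\<close>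
  (\<open>decay_Lp\<close> with one integration by parts). The harmonic sum thus beats the Besov norm by a factor
  of order \<open>log (1/w)\<close>. Placing one such bump inside every block \<open>[4\<^sup>l, 4\<^sup>l\<^sup>+\<^sup>1]\<close>, with Besov norms that
  are summable and widths that make the logarithms grow faster, gives a symbol in the Besov class
  whose operator has Schatten sums that exceed every bound (\<open>\<psi>_besov\<close>, \<open>\<psi>_not_schatten\<close>).

  The lower bounds for singular values use only the definition by approximation: an operator of rank
  at most \<open>j\<close> annihilates a nonzero combination of any \<open>j + 1\<close> functions, so it cannot come closer to
  \<open>T\<close> than the lower bound of \<open>T\<close> on their span (\<open>sing_val_ge\<close>).
\<close>

section \<open>Smooth functions and test functions\<close>

lemma vderiv_has_vector_derivative:
  assumes "f differentiable at x"
  shows "(f has_vector_derivative vderiv f x) (at x)"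
  using assms by (simp add: vderiv_def vector_derivative_works)

lemma vderiv_eqI: "(\<And>x. (f has_vector_derivative f' x) (at x)) \<Longrightarrow> vderiv f = f'"
  by (auto simp: vderiv_def vector_derivative_at)

text \<open>
  Differentiability of finite order is what induction can handle: a product rule for \<open>n + 1\<close>
  derivatives of \<open>f\<close> and \<open>g\<close> reduces to \<open>n\<close> derivatives of \<open>f\<close>, \<open>g\<close>, \<open>f'\<close> and \<open>g'\<close>.
\<close>

definition ndiff :: "nat \<Rightarrow> (real \<Rightarrow> complex) \<Rightarrow> bool" where
  "ndiff n f \<longleftrightarrow> (\<forall>k\<le>n. \<forall>x. (vderiv ^^ k) f differentiable at x)"

lemma smooth_iff_ndiff: "smooth f \<longleftrightarrow> (\<forall>n. ndiff n f)"
  by (auto simp: smooth_def ndiff_def)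

lemma ndiff_0: "ndiff 0 f \<longleftrightarrow> (\<forall>x. f differentiable at x)"
  by (simp add: ndiff_def)

lemma ndiff_Suc: "ndiff (Suc n) f \<longleftrightarrow> (\<forall>x. f differentiable at x) \<and> ndiff n (vderiv f)"
  unfolding ndiff_def
proof safe
  fix k x assume *: "\<forall>k\<le>Suc n. \<forall>x. (vderiv ^^ k) f differentiable at x"
  show "f differentiable at x" using *[rule_format, of 0 x] by simp
  assume "k \<le> n"
  then show "(vderiv ^^ k) (vderiv f) differentiable at x"
    using *[rule_format, of "Suc k" x] by (simp add: funpow_swap1)
next
  fix k x assume *: "\<forall>x. f differentiable at x" "\<forall>k\<le>n. \<forall>x. (vderiv ^^ k) (vderiv f) differentiable at x"
    and "k \<le> Suc n"
  then show "(vderiv ^^ k) f differentiable at x"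
    by (cases k) (auto simp: funpow_swap1)
qed

lemma ndiff_le: "ndiff n f \<Longrightarrow> m \<le> n \<Longrightarrow> ndiff m f"
  by (auto simp: ndiff_def)

lemma ndiff_Suc_derivative:
  assumes "ndiff (Suc n) f"
  shows "\<And>x. (f has_vector_derivative vderiv f x) (at x)" "ndiff n (vderiv f)" "ndiff n f"
  using assms ndiff_le[of "Suc n" f n] by (auto simp: ndiff_Suc intro: vderiv_has_vector_derivative)

lemma ndiff_SucI:
  assumes "\<And>x. (f has_vector_derivative f' x) (at x)" "ndiff n f'"
  shows "ndiff (Suc n) f"
  using assms vderiv_eqI[OF assms(1)] unfolding ndiff_Suc
  by (metis differentiableI_vector)

lemma ndiff_const: "ndiff n (\<lambda>x. c)"
proof (induction n arbitrary: c)
  case (Suc n)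
  show ?case by (rule ndiff_SucI[OF _ Suc.IH[of 0]]) auto
qed (simp add: ndiff_0)

lemma ndiff_add: "ndiff n f \<Longrightarrow> ndiff n g \<Longrightarrow> ndiff n (\<lambda>x. f x + g x)"
proof (induction n arbitrary: f g)
  case (Suc n)
  note f = ndiff_Suc_derivative[OF Suc.prems(1)] and g = ndiff_Suc_derivative[OF Suc.prems(2)]
  show ?case
    by (rule ndiff_SucI[OF _ Suc.IH[OF f(2) g(2)]]) (intro derivative_intros f g)
qed (auto simp: ndiff_0)

lemma ndiff_mult: "ndiff n f \<Longrightarrow> ndiff n g \<Longrightarrow> ndiff n (\<lambda>x. f x * g x)"
proof (induction n arbitrary: f g)
  case (Suc n)
  note f = ndiff_Suc_derivative[OF Suc.prems(1)] and g = ndiff_Suc_derivative[OF Suc.prems(2)]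
  show ?case
    by (rule ndiff_SucI[OF _ ndiff_add[OF Suc.IH[OF f(3) g(2)] Suc.IH[OF f(2) g(3)]]])
      (intro has_vector_derivative_mult f g)
qed (auto simp: ndiff_0)

lemma ndiff_cnj: "ndiff n f \<Longrightarrow> ndiff n (\<lambda>x. cnj (f x))"
proof (induction n arbitrary: f)
  case 0
  then show ?case
    by (auto simp: ndiff_0 vector_derivative_works[of f] intro!: differentiableI_vector has_vector_derivative_cnj)
next
  case (Suc n)
  note f = ndiff_Suc_derivative[OF Suc.prems]
  show ?case
    by (rule ndiff_SucI[OF _ Suc.IH[OF f(2)]]) (rule has_vector_derivative_cnj, rule f(1))
qed

lemma has_vector_derivative_affine:
  fixes f :: "real \<Rightarrow> complex"
  assumes "\<And>x. (f has_vector_derivative f' x) (at x)"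
  shows "((\<lambda>x. f (a * x + b)) has_vector_derivative of_real a * f' (a * x + b)) (at x)"
proof -
  have "((\<lambda>x. a * x + b) has_vector_derivative a) (at x)"
    by (auto intro!: derivative_eq_intros simp flip: has_real_derivative_iff_has_vector_derivative)
  from vector_diff_chain_at[OF this assms]
  show ?thesis by (simp add: o_def scaleR_conv_of_real)
qed

lemma ndiff_affine: "ndiff n f \<Longrightarrow> ndiff n (\<lambda>x. f (a * x + b))"
proof (induction n arbitrary: f)
  case 0
  then show ?case
    unfolding ndiff_0 using vderiv_has_vector_derivative
    by (blast intro: differentiableI_vector has_vector_derivative_affine)
next
  case (Suc n)
  note f = ndiff_Suc_derivative[OF Suc.prems]
  show ?case
    by (rule ndiff_SucI[OF has_vector_derivative_affine[OF f(1)] ndiff_mult[OF ndiff_const Suc.IH[OF f(2)]]])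
qed

lemma smooth_const: "smooth (\<lambda>x. c)"
  and smooth_add: "smooth f \<Longrightarrow> smooth g \<Longrightarrow> smooth (\<lambda>x. f x + g x)"
  and smooth_mult: "smooth f \<Longrightarrow> smooth g \<Longrightarrow> smooth (\<lambda>x. f x * g x)"
  and smooth_cnj: "smooth f \<Longrightarrow> smooth (\<lambda>x. cnj (f x))"
  and smooth_affine: "smooth f \<Longrightarrow> smooth (\<lambda>x. f (a * x + b))"
  by (simp_all add: smooth_iff_ndiff ndiff_const ndiff_add ndiff_mult ndiff_cnj ndiff_affine)

lemma smooth_vderiv: "smooth f \<Longrightarrow> smooth (vderiv f)"
  using ndiff_Suc_derivative(2) by (auto simp: smooth_iff_ndiff)

lemma smooth_has_vector_derivative: "smooth f \<Longrightarrow> (f has_vector_derivative vderiv f x) (at x)"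
  by (auto simp: smooth_iff_ndiff ndiff_Suc intro: ndiff_Suc_derivative(1))

lemma smooth_continuous: "smooth f \<Longrightarrow> continuous_on A f"
  by (intro continuous_at_imp_continuous_on ballI
      has_vector_derivative_continuous[OF smooth_has_vector_derivative])

lemma smooth_borel_measurable: "smooth f \<Longrightarrow> f \<in> borel_measurable borel"
  by (intro borel_measurable_continuous_onI smooth_continuous)

lemma supp_subset_iff: "closed K \<Longrightarrow> supp f \<subseteq> K \<longleftrightarrow> (\<forall>x. x \<notin> K \<longrightarrow> f x = 0)"
  unfolding supp_def using closure_minimal[of "{x. f x \<noteq> 0}" K] closure_subset[of "{x. f x \<noteq> 0}"] by blast

lemma test_functions_iff:
  "f \<in> test_functions \<longleftrightarrow> smooth f \<and> (\<exists>K. compact K \<and> K \<subseteq> {0<..} \<and> (\<forall>x. x \<notin> K \<longrightarrow> f x = 0))"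
proof
  assume "f \<in> test_functions"
  then show "smooth f \<and> (\<exists>K. compact K \<and> K \<subseteq> {0<..} \<and> (\<forall>x. x \<notin> K \<longrightarrow> f x = 0))"
    using supp_subset_iff[of "supp f" f] by (auto simp: test_functions_def compact_imp_closed)
next
  assume *: "smooth f \<and> (\<exists>K. compact K \<and> K \<subseteq> {0<..} \<and> (\<forall>x. x \<notin> K \<longrightarrow> f x = 0))"
  then obtain K where K: "compact K" "K \<subseteq> {0<..}" "supp f \<subseteq> K"
    using supp_subset_iff compact_imp_closed by blast
  moreover have "closed (supp f)" by (simp add: supp_def)
  then have "compact (supp f)"
    using compact_Int_closed[OF K(1)] K(3) by (metis Int_absorb1)
  ultimately show "f \<in> test_functions" using * by (auto simp: test_functions_def)
qed

lemma test_functionI: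
  assumes "smooth f" "0 < a" "\<And>x. x \<notin> {a..b} \<Longrightarrow> f x = 0"
  shows "f \<in> test_functions"
proof -
  have "compact {a..b}" "{a..b} \<subseteq> {0<..}" using assms(2) by auto
  with assms(1,3) show ?thesis unfolding test_functions_iff by blast
qed

lemma test_functions_add:
  assumes "f \<in> test_functions" "g \<in> test_functions"
  shows "(\<lambda>x. f x + g x) \<in> test_functions"
proof -
  obtain K where "smooth f" "compact K" "K \<subseteq> {0<..}" "\<forall>x. x \<notin> K \<longrightarrow> f x = 0"
    using assms(1) unfolding test_functions_iff by blast
  moreover obtain K' where "smooth g" "compact K'" "K' \<subseteq> {0<..}" "\<forall>x. x \<notin> K' \<longrightarrow> g x = 0"
    using assms(2) unfolding test_functions_iff by blast
  ultimately show ?thesis unfolding test_functions_iff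
    by (intro conjI smooth_add exI[of _ "K \<union> K'"]) auto
qed

lemma test_functions_scale: "f \<in> test_functions \<Longrightarrow> (\<lambda>x. c * f x) \<in> test_functions"
  unfolding test_functions_iff by (auto intro!: smooth_mult smooth_const)

lemma test_functions_sum:
  "finite I \<Longrightarrow> (\<And>i. i \<in> I \<Longrightarrow> f i \<in> test_functions) \<Longrightarrow> (\<lambda>x. \<Sum>i\<in>I. f i x) \<in> test_functions"
proof (induction I rule: finite_induct)
  case empty
  then show ?case by (auto simp: test_functions_iff intro: smooth_const exI[of _ "{}"])
qed (auto intro: test_functions_add)

lemma smooth_compact_bounded:
  assumes "smooth f" "\<And>x. x \<notin> {a..b} \<Longrightarrow> f x = 0"
  obtains M where "M \<ge> 0" "\<And>x. norm (f x) \<le> M"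
proof -
  have "bounded (f ` {a..b})"
    by (intro compact_imp_bounded compact_continuous_image smooth_continuous assms) auto
  then obtain M where M: "\<forall>x\<in>{a..b}. norm (f x) \<le> M" unfolding bounded_iff by auto
  show ?thesis
  proof (rule that[of "max M 0"])
    show "norm (f x) \<le> max M 0" for x using M assms(2)[of x] by (cases "x \<in> {a..b}") (auto simp: le_max_iff_disj)
  qed simp
qed

lemma dyadic_cutoff_props:
  assumes "dyadic_cutoff v"
  shows "smooth v" "\<And>x. x \<notin> {1/2..2} \<Longrightarrow> v x = 0"
  using assms supp_subset_iff[of "{1/2..2}" v] by (auto simp: dyadic_cutoff_def)

text \<open>
  A bump is extracted from the cutoff: \<open>\<bar>v\<bar>\<^sup>2 = v \<cdot> cnj v\<close> is smooth,
  nonnegative and compactly supported, and it does not vanish identically because the dilates of \<open>v\<close>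
  sum to \<open>1\<close>. Zooming in at a point where it is positive and normalising makes it at least \<open>1\<close> on
  \<open>[-1, 1]\<close>, at the price of a larger support \<open>[-L, L]\<close>.
\<close>

lemma dyadic_cutoff_bump:
  assumes "dyadic_cutoff v"
  obtains \<eta> :: "real \<Rightarrow> real" and L B :: real
  where "L \<ge> 1" "smooth (\<lambda>t. of_real (\<eta> t))" "\<And>t. 0 \<le> \<eta> t" "\<And>t. \<eta> t \<le> B"
    "\<And>t. \<bar>t\<bar> \<le> 1 \<Longrightarrow> 1 \<le> \<eta> t" "\<And>t. L < \<bar>t\<bar> \<Longrightarrow> \<eta> t = 0"
proof -
  note v = dyadic_cutoff_props[OF assms]
  have hs: "((\<lambda>j::int. v (1 / 2 powi j)) has_sum 1) UNIV"
    using assms by (auto simp: dyadic_cutoff_def)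
  have "\<exists>t0. v t0 \<noteq> 0"
  proof (rule ccontr)
    assume "\<not> ?thesis"
    then have "((\<lambda>j::int. v (1 / 2 powi j)) has_sum 0) UNIV" by (simp)
    with hs show False using has_sum_unique by force
  qed
  then obtain t0 where t0: "v t0 \<noteq> 0" by blast
  then have t0': "t0 \<in> {1/2..2}" using v(2) by blast
  define w where "w t = (norm (v t))\<^sup>2" for t
  define c where "c = w t0 / 2"
  have c: "c > 0" using t0 by (simp add: c_def w_def)
  have contw: "continuous_on UNIV w"
    unfolding w_def by (intro continuous_intros smooth_continuous v)
  then have "isCont w t0" by (simp add: continuous_on_eq_continuous_at)
  then obtain r where r: "r > 0" "\<And>t. dist t t0 < r \<Longrightarrow> dist (w t) (w t0) < c"
    using c unfolding continuous_at_eps_delta by metis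
  define r' where "r' = r / 2"
  have r': "r' > 0" "\<And>t. \<bar>t - t0\<bar> \<le> r' \<Longrightarrow> c \<le> w t"
    using r(1) r(2) unfolding r'_def dist_real_def c_def
    by (auto simp: abs_if split: if_splits) (smt (verit) field_sum_of_halves)+
  define \<eta> where "\<eta> u = w (t0 + r' * u) / c" for u
  define L where "L = 2 / r' + 1"
  have wz: "w t = 0" if "t \<notin> {1/2..2}" for t using v(2)[OF that] by (simp add: w_def)
  have chiz: "\<eta> t = 0" if "L < \<bar>t\<bar>" for t
  proof -
    have "2 / r' < \<bar>t\<bar>" using that by (simp add: L_def)
    then have "2 < \<bar>r' * t\<bar>" using r'(1) by (simp add: field_simps abs_mult)
    then have "t0 + r' * t \<notin> {1/2..2}" using t0' by auto
    then show ?thesis using wz by (simp add: \<eta>_def)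
  qed
  obtain V where V: "V \<ge> 0" "\<And>t. norm (v t) \<le> V" using smooth_compact_bounded[OF v] by blast
  then have B: "w t \<le> V\<^sup>2" for t unfolding w_def by (intro power_mono) auto
  show ?thesis
  proof (rule that)
    show "L \<ge> 1" using r'(1) by (simp add: L_def)
    have "smooth (\<lambda>u. of_real (1/c) * (v (r' * u + t0) * cnj (v (r' * u + t0))))"
      by (intro smooth_mult smooth_const smooth_cnj smooth_affine v)
    then show "smooth (\<lambda>t. of_real (\<eta> t))"
      by (simp add: \<eta>_def w_def complex_norm_square[symmetric] add.commute divide_inverse mult.commute)
    show "\<eta> t \<le> V\<^sup>2 / c" for t unfolding \<eta>_def using c B by (intro divide_right_mono) auto
    show "1 \<le> \<eta> t" if "\<bar>t\<bar> \<le> 1" for t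
      using that c r' by (simp add: \<eta>_def abs_mult)
  qed (use c chiz in \<open>auto simp: \<eta>_def w_def\<close>)
qed

section \<open>Fourier transforms of compactly supported functions\<close>

definition fourier :: "(real \<Rightarrow> complex) \<Rightarrow> real \<Rightarrow> complex" where
  "fourier g \<xi> = (LBINT x. g x * exp (- (\<i> * of_real x * of_real \<xi>)))"

lemma integrable_continuous_compact_support:
  fixes g :: "real \<Rightarrow> complex"
  assumes "continuous_on UNIV g" "\<And>x. x \<notin> {a..b} \<Longrightarrow> g x = 0"
  shows "integrable lborel g"
proof -
  have "set_integrable lborel {a..b} g"
    by (rule borel_integrable_atLeastAtMost') (rule continuous_on_subset[OF assms(1)], simp)
  moreover have "indicator {a..b} x *\<^sub>R g x = g x" for x
    using assms(2)[of x] by (auto simp: indicator_def)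
  ultimately show ?thesis by (simp add: set_integrable_def)
qed

lemma continuous_fourier_kernel: "continuous_on A (\<lambda>x. exp (- (\<i> * complex_of_real x * of_real \<xi>)))"
  by (intro continuous_intros)

lemma norm_fourier_kernel [simp]: "norm (exp (- (\<i> * complex_of_real x * of_real \<xi>))) = 1"
  by (simp add: norm_exp_eq_Re)

text \<open>
  Integration by parts. The fundamental theorem of calculus is applied on \<open>[a - 1, b + 1]\<close>, where the
  boundary values are zero because they lie outside the support.
\<close>

lemma fourier_deriv:
  fixes g g' :: "real \<Rightarrow> complex"
  assumes g: "\<And>x. (g has_vector_derivative g' x) (at x)" "continuous_on UNIV g'"
    and z: "\<And>x. x \<notin> {a..b} \<Longrightarrow> g x = 0"
  shows "fourier g' \<xi> = \<i> * of_real \<xi> * fourier g \<xi>" and "\<And>x. x \<notin> {a..b} \<Longrightarrow> g' x = 0"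
proof -
  show z': "g' x = 0" if "x \<notin> {a..b}" for x
  proof -
    have "open (- {a..b})" by (simp add: open_Compl)
    then have "((\<lambda>x. 0) has_vector_derivative g' x) (at x)"
      by (rule has_vector_derivative_transform_within_open[OF g(1)]) (use that z in auto)
    then show ?thesis using vector_derivative_unique_at has_vector_derivative_const by blast
  qed
  define e where "e x = exp (- (\<i> * complex_of_real x * of_real \<xi>))" for x
  have cg: "continuous_on UNIV g"
    using g(1) has_vector_derivative_continuous by (blast intro: continuous_at_imp_continuous_on)
  have ce: "continuous_on UNIV e" unfolding e_def by (rule continuous_fourier_kernel)
  have e: "(e has_vector_derivative - (\<i> * of_real \<xi>) * e x) (at x)" for x
  proof -
    have "((\<lambda>z. exp (- (\<i> * z * of_real \<xi>))) has_field_derivative - (\<i> * of_real \<xi>) * e x) (at (of_real x))"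
      unfolding e_def by (auto intro!: derivative_eq_intros)
    from has_vector_derivative_real_field[OF this]
    show ?thesis unfolding e_def .
  qed
  define h where "h x = g' x * e x - \<i> * of_real \<xi> * (g x * e x)" for x
  have "((\<lambda>x. g x * e x) has_vector_derivative g x * (- (\<i> * of_real \<xi>) * e x) + g' x * e x) (at x)" for x
    by (intro has_vector_derivative_mult g e)
  then have H: "((\<lambda>x. g x * e x) has_vector_derivative h x) (at x)" for x
    by (simp add: h_def algebra_simps)
  have hz: "h x = 0" if "x \<notin> {a..b}" for x using z'[OF that] z[OF that] by (simp add: h_def)
  have "(LBINT x. h x) = 0"
  proof (cases "a \<le> b")
    case True
    have "(LBINT x. indicator {a-1..b+1} x *\<^sub>R h x) = g (b+1) * e (b+1) - g (a-1) * e (a-1)"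
      by (rule integral_FTC_Icc)
        (use True in \<open>auto simp: h_def intro!: has_vector_derivative_at_within[OF H[unfolded h_def]] continuous_intros continuous_on_subset[OF cg]
            continuous_on_subset[OF ce] continuous_on_subset[OF g(2)]\<close>)
    also have "\<dots> = 0" using True by (simp add: z)
    also have "(LBINT x. indicator {a-1..b+1} x *\<^sub>R h x) = (LBINT x. h x)"
      by (rule Bochner_Integration.integral_cong) (use hz in \<open>auto simp: indicator_def\<close>)
    finally show ?thesis .
  next
    case False
    then have "h x = 0" for x using hz[of x] by auto
    then show ?thesis by simp
  qed
  moreover have "(LBINT x. h x) = (LBINT x. g' x * e x) - (LBINT x. \<i> * of_real \<xi> * (g x * e x))"
    unfolding h_def
    by (intro Bochner_Integration.integral_diff integrable_mult_right integrable_continuous_compact_support[of _ a b]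
        continuous_on_mult g cg ce)
      (use z z' in auto)
  ultimately show "fourier g' \<xi> = \<i> * of_real \<xi> * fourier g \<xi>"
    by (simp add: fourier_def e_def[symmetric])
qed

lemma fourier_le:
  fixes g :: "real \<Rightarrow> complex"
  assumes "continuous_on UNIV g" "\<And>x. x \<notin> {a..b} \<Longrightarrow> g x = 0" "a \<le> b" "\<And>x. norm (g x) \<le> M"
  shows "norm (fourier g \<xi>) \<le> M * (b - a)"
proof -
  have "norm (fourier g \<xi>) \<le> (LBINT x. norm (g x))"
    unfolding fourier_def
    by (rule order.trans[OF integral_norm_bound]) (simp add: norm_mult)
  also have "\<dots> \<le> (LBINT x. M * indicator {a..b} x)"
  proof (rule integral_mono)
    show "integrable lborel (\<lambda>x. norm (g x))"
      by (rule integrable_norm[OF integrable_continuous_compact_support[OF assms(1,2)]])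
    show "integrable lborel (\<lambda>x. M * indicator {a..b} x)"
      using assms(3) by (intro integrable_mult_right integrable_real_indicator) auto
    show "norm (g x) \<le> M * indicator {a..b} x" for x
      using assms(2,4)[of x] by (auto simp: indicator_def)
  qed
  also have "\<dots> = M * (b - a)" using assms by simp
  finally show ?thesis .
qed

lemma fourier_higher_deriv:
  assumes "smooth g" "\<And>x. x \<notin> {a..b} \<Longrightarrow> g x = 0"
  shows "fourier ((vderiv ^^ m) g) \<xi> = (\<i> * of_real \<xi>) ^ m * fourier g \<xi> \<and>
    smooth ((vderiv ^^ m) g) \<and> (\<forall>x. x \<notin> {a..b} \<longrightarrow> (vderiv ^^ m) g x = 0)"
proof (induction m)
  case (Suc m)
  then show ?case
    using fourier_deriv[OF smooth_has_vector_derivative smooth_continuous[OF smooth_vderiv], of "(vderiv ^^ m) g" a b]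
    by (auto intro: smooth_vderiv)
qed (use assms in auto)

lemma fourier_measurable:
  assumes "g \<in> borel_measurable borel"
  shows "fourier g \<in> borel_measurable borel"
proof -
  have "(\<lambda>(\<xi>, x). g x * exp (- (\<i> * complex_of_real x * of_real \<xi>)))
      \<in> borel_measurable (borel \<Otimes>\<^sub>M lborel)"
    using assms by measurable
  from lborel.borel_measurable_lebesgue_integral[OF this]
  show ?thesis unfolding fourier_def[abs_def] by simp
qed

definition cauchy_mass :: real where
  "cauchy_mass = (LBINT x. 2 / (1 + x\<^sup>2))"

lemma integrable_cauchy: "integrable lborel (\<lambda>x::real. 2 / (1 + x\<^sup>2))"
proof -
  have "integrable lborel (\<lambda>x::real. 2 * inverse (1 + x\<^sup>2))"
    using integrable_inverse_1_plus_square
    by (intro integrable_mult_right) (simp add: set_integrable_def einterval_def)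
  then show ?thesis by (simp add: divide_inverse)
qed

lemma cauchy_mass_nonneg: "0 \<le> cauchy_mass"
  unfolding cauchy_mass_def by (intro integral_nonneg_AE AE_I2) (auto intro!: divide_nonneg_nonneg)

text \<open>
  A Fourier transform bounded by \<open>D\<close> that decays like \<open>D / \<bar>w \<xi>\<bar>\<^sup>m\<close> lives essentially on \<open>\<bar>\<xi>\<bar> \<le> 1/w\<close>, so
  the integral of its \<open>p\<close>-th power is of order \<open>D\<^sup>p / w\<close>. As \<open>m p \<ge> 2\<close>, the \<open>p\<close>-th power is dominated by a
  Cauchy density. For a bump of height \<open>a\<close> and width \<open>w\<close> one has \<open>D\<close> of order \<open>a w\<close>, which yields the bound
  \<open>a\<^sup>p w\<^sup>p\<^sup>-\<^sup>1\<close>.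
\<close>

lemma decay_Lp:
  fixes h :: "real \<Rightarrow> complex"
  assumes [measurable]: "h \<in> borel_measurable borel"
    and D: "\<And>\<xi>. norm (h \<xi>) \<le> D" "\<And>\<xi>. \<bar>w * \<xi>\<bar> ^ m * norm (h \<xi>) \<le> D"
    and w: "w > 0" and p: "p > 0" "real m * p \<ge> 2"
  shows "in_Lp p h" and "(LBINT \<xi>. norm (h \<xi>) powr p) \<le> D powr p * cauchy_mass / w"
proof -
  have bnd: "norm (h \<xi>) powr p \<le> D powr p * (2 / (1 + (w * \<xi>)\<^sup>2))" for \<xi>
  proof (cases "\<bar>w * \<xi>\<bar> \<le> 1")
    case True
    then have "(w * \<xi>)\<^sup>2 \<le> 1" by (simp add: abs_square_le_1)
    then have "1 \<le> 2 / (1 + (w * \<xi>)\<^sup>2)" by (simp add: add_pos_nonneg)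
    moreover have "norm (h \<xi>) powr p \<le> D powr p" using D(1) p by (intro powr_mono2) auto
    ultimately show ?thesis
      using mult_mono[of "norm (h \<xi>) powr p" "D powr p" 1 "2 / (1 + (w * \<xi>)\<^sup>2)"] by simp
  next
    case False
    define t where "t = \<bar>w * \<xi>\<bar>"
    have t: "t > 1" using False by (simp add: t_def)
    have "norm (h \<xi>) \<le> D * t powr (- real m)"
    proof -
      have "t ^ m * norm (h \<xi>) \<le> D" using D(2)[of \<xi>] by (simp add: t_def)
      then show ?thesis using t by (simp add: powr_minus powr_realpow field_simps)
    qed
    then have "norm (h \<xi>) powr p \<le> (D * t powr (- real m)) powr p"
      using p by (intro powr_mono2) auto
    also have "\<dots> = D powr p * t powr (- (real m * p))"
      using D(1)[of 0] norm_ge_zero[of "h 0"] by (subst powr_mult) (auto simp: powr_powr)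
    also have "\<dots> \<le> D powr p * t powr (- 2)"
      using t p by (intro mult_left_mono powr_mono) auto
    also have "t powr (-2) = 1 / t\<^sup>2"
      using t by (simp add: powr_minus powr_numeral divide_inverse)
    also have "1 / t\<^sup>2 \<le> 2 / (1 + t\<^sup>2)"
    proof -
      have "1 \<le> t\<^sup>2" using t by (simp add: one_le_power)
      then show ?thesis using t by (simp add: field_simps add_pos_pos)
    qed
    finally show ?thesis by (simp add: t_def mult_left_mono)
  qed
  have i: "integrable lborel (\<lambda>\<xi>. D powr p * (2 / (1 + (w * \<xi>)\<^sup>2)))"
    using lborel_integrable_real_affine[OF integrable_cauchy, of w 0] w
    by (intro integrable_mult_right) auto
  have i': "integrable lborel (\<lambda>\<xi>. norm (h \<xi>) powr p)"
    by (rule Bochner_Integration.integrable_bound[OF i]) (use bnd in \<open>auto intro!: AE_I2 order.trans[OF bnd] \<close>)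
  then show "in_Lp p h" by (simp add: in_Lp_def)
  have "(LBINT \<xi>. norm (h \<xi>) powr p) \<le> (LBINT \<xi>. D powr p * (2 / (1 + (w * \<xi>)\<^sup>2)))"
    by (intro integral_mono i i' bnd)
  moreover have "(LBINT \<xi>. 2 / (1 + (w * \<xi>)\<^sup>2)) = cauchy_mass / w"
    unfolding cauchy_mass_def using w
    by (subst (2) lborel_integral_real_affine[where c = w and t = 0]) (auto)
  ultimately show "(LBINT \<xi>. norm (h \<xi>) powr p) \<le> D powr p * cauchy_mass / w"
    by (simp only: integral_mult_right_zero times_divide_eq_right[symmetric])
qed

lemma besov_block_regular:
  assumes "\<And>x. x \<le> 0 \<Longrightarrow> v x = 0"
  shows "besov_block v j (regular_dist \<psi>) = fourier (\<lambda>x. v (x / 2 powi j) * \<psi> x)"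
proof
  fix \<xi>
  have z: "v (x / 2 powi j) = 0" if "x \<le> 0" for x
    using that by (intro assms) (auto simp: divide_nonpos_pos)
  show "besov_block v j (regular_dist \<psi>) \<xi> = fourier (\<lambda>x. v (x / 2 powi j) * \<psi> x) \<xi>"
    unfolding besov_block_def fourier_dist_def dist_mult_def regular_dist_def fourier_def
      set_lebesgue_integral_def
    by (rule Bochner_Integration.integral_cong) (use z in \<open>auto simp: indicator_def mult_ac not_less\<close>)
qed

lemma Lp_norm_powr:
  assumes "p > 0"
  shows "(2 powr (j * s) * Lp_norm p h) powr p = 2 powr (j * s * p) * (LBINT x. norm (h x) powr p)"
proof -
  have "0 \<le> (LBINT x. norm (h x) powr p)" by (rule integral_nonneg_AE) simp
  then show ?thesis using assms by (simp add: powr_mult Lp_norm_def powr_powr)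
qed

section \<open>Lower bounds for singular values\<close>

lemma Rplus_sets [simp, measurable]: "{0<..} \<inter> space lborel \<in> sets (lborel :: real measure)"
  by simp

lemma space_Rplus: "space Rplus = {0<..}"
  by (simp add: space_restrict_space)

lemma L2I_measurable: "f \<in> borel_measurable borel \<Longrightarrow> f \<in> borel_measurable Rplus"
  by (rule measurable_restrict_space1) simp

lemma L2_norm_nonneg [simp]: "0 \<le> L2_norm f"
  by (auto simp: L2_norm_def intro!: integral_nonneg_AE)

lemma L2_norm_sq: "(L2_norm f)\<^sup>2 = (LINT x|Rplus. (norm (f x))\<^sup>2)"
  by (auto simp: L2_norm_def intro!: integral_nonneg_AE)

lemma L2_norm_cong_AE:
  assumes "f \<in> L2" "g \<in> L2" "AE x in Rplus. f x = g x"
  shows "L2_norm f = L2_norm g"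
proof -
  have [measurable]: "f \<in> borel_measurable Rplus" "g \<in> borel_measurable Rplus"
    using assms by (auto simp: L2_def)
  have "(LINT x|Rplus. (norm (f x))\<^sup>2) = (LINT x|Rplus. (norm (g x))\<^sup>2)"
    by (rule integral_cong_AE) (use assms(3) in auto)
  then show ?thesis by (simp add: L2_norm_def)
qed

lemma L2_scale:
  assumes "f \<in> L2"
  shows "(\<lambda>x. c * f x) \<in> L2" "L2_norm (\<lambda>x. c * f x) = norm c * L2_norm f"
  using assms by (auto simp: L2_def L2_norm_def norm_mult power_mult_distrib real_sqrt_mult)

lemma norm_add_sq_le: "(norm (a + b :: complex))\<^sup>2 \<le> 2 * (norm a)\<^sup>2 + 2 * (norm b)\<^sup>2"
proof -
  have "(norm (a + b))\<^sup>2 \<le> (norm a + norm b)\<^sup>2"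
    by (intro power_mono norm_triangle_ineq) auto
  also have "\<dots> \<le> 2 * (norm a)\<^sup>2 + 2 * (norm b)\<^sup>2"
    using zero_le_power2[of "norm a - norm b"] unfolding power2_diff power2_sum by linarith
  finally show ?thesis .
qed

lemma L2_add:
  assumes "f \<in> L2" "g \<in> L2"
  shows "(\<lambda>x. f x + g x) \<in> L2"
    and "(L2_norm (\<lambda>x. f x + g x))\<^sup>2 \<le> 2 * (L2_norm f)\<^sup>2 + 2 * (L2_norm g)\<^sup>2"
proof -
  have [measurable]: "f \<in> borel_measurable Rplus" "g \<in> borel_measurable Rplus"
    and i: "integrable Rplus (\<lambda>x. (norm (f x))\<^sup>2)" "integrable Rplus (\<lambda>x. (norm (g x))\<^sup>2)"
    using assms by (auto simp: L2_def)
  have i2: "integrable Rplus (\<lambda>x. 2 * (norm (f x))\<^sup>2 + 2 * (norm (g x))\<^sup>2)"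
    using i by auto
  have i3: "integrable Rplus (\<lambda>x. (norm (f x + g x))\<^sup>2)"
    by (rule Bochner_Integration.integrable_bound[OF i2])
      (auto intro!: AE_I2 order.trans[OF norm_add_sq_le])
  show "(\<lambda>x. f x + g x) \<in> L2" using i3 by (simp add: L2_def)
  have "(LINT x|Rplus. (norm (f x + g x))\<^sup>2) \<le> (LINT x|Rplus. 2 * (norm (f x))\<^sup>2 + 2 * (norm (g x))\<^sup>2)"
    by (intro integral_mono i3 i2 norm_add_sq_le)
  then show "(L2_norm (\<lambda>x. f x + g x))\<^sup>2 \<le> 2 * (L2_norm f)\<^sup>2 + 2 * (L2_norm g)\<^sup>2"
    using i by (simp add: L2_norm_sq)
qed

lemma L2_diff:
  assumes "f \<in> L2" "g \<in> L2"
  shows "(\<lambda>x. f x - g x) \<in> L2"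
    and "(L2_norm (\<lambda>x. f x - g x))\<^sup>2 \<le> 2 * (L2_norm f)\<^sup>2 + 2 * (L2_norm g)\<^sup>2"
  using L2_add[OF assms(1) L2_scale(1)[OF assms(2), of "-1"]] L2_scale(2)[OF assms(2), of "-1"]
  by simp_all

lemma L2_zero: "(\<lambda>x. 0) \<in> L2"
  by (simp add: L2_def)

lemma L2_sum: "(\<And>i. i \<in> I \<Longrightarrow> f i \<in> L2) \<Longrightarrow> (\<lambda>x. \<Sum>i\<in>I. f i x) \<in> L2"
  by (induction I rule: infinite_finite_induct) (auto simp: L2_zero L2_add)

text \<open>
  Norms are estimated from both sides by comparing \<open>\<bar>f\<bar>\<^sup>2\<close> with step functions, whose
  integrals are finite sums.
\<close>

lemma step_integral:
  fixes a b h :: "'i \<Rightarrow> real"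
  assumes "\<And>i. i \<in> I \<Longrightarrow> 0 < a i \<and> a i \<le> b i"
  shows "integrable Rplus (\<lambda>x. \<Sum>i\<in>I. h i * indicator {a i..b i} x)"
    and "(LINT x|Rplus. (\<Sum>i\<in>I. h i * indicator {a i..b i} x)) = (\<Sum>i\<in>I. h i * (b i - a i))"
proof -
  have eq: "indicator {0<..} x * indicator {a i..b i} x = (indicator {a i..b i} x :: real)"
    if "i \<in> I" for i x
    using assms[OF that] by (auto simp: indicator_def)
  have *: "integrable Rplus (indicator {a i..b i} :: real \<Rightarrow> real)"
    "(LINT x|Rplus. (indicator {a i..b i} x :: real)) = b i - a i" if "i \<in> I" for i
  proof -
    show "integrable Rplus (indicator {a i..b i} :: real \<Rightarrow> real)"
      by (subst integrable_restrict_space)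
        (simp_all add: eq[OF that] set_integrable_def integrable_real_indicator emeasure_lborel_Icc_eq)
    show "(LINT x|Rplus. (indicator {a i..b i} x :: real)) = b i - a i"
      unfolding integral_restrict_space[OF Rplus_sets] real_scaleR_def eq[OF that]
      using assms[OF that] by simp
  qed
  then show "integrable Rplus (\<lambda>x. \<Sum>i\<in>I. h i * indicator {a i..b i} x)"
    by (intro Bochner_Integration.integrable_sum integrable_mult_right) auto
  show "(LINT x|Rplus. (\<Sum>i\<in>I. h i * indicator {a i..b i} x)) = (\<Sum>i\<in>I. h i * (b i - a i))"
    using * by (subst Bochner_Integration.integral_sum) (auto intro!: sum.cong integrable_mult_right)
qed

lemma L2_norm_le_step:
  fixes a b h :: "'i \<Rightarrow> real"
  assumes "finite I" and ab: "\<And>i. i \<in> I \<Longrightarrow> 0 < a i \<and> a i \<le> b i" and h: "\<And>i. i \<in> I \<Longrightarrow> 0 \<le> h i"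
    and f: "f \<in> borel_measurable borel"
    and out: "\<And>x. x > 0 \<Longrightarrow> f x \<noteq> 0 \<Longrightarrow> \<exists>i\<in>I. x \<in> {a i..b i} \<and> (norm (f x))\<^sup>2 \<le> h i"
  shows "f \<in> L2" and "(L2_norm f)\<^sup>2 \<le> (\<Sum>i\<in>I. h i * (b i - a i))"
proof -
  note [measurable] = L2I_measurable[OF f]
  have le: "(norm (f x))\<^sup>2 \<le> (\<Sum>i\<in>I. h i * indicator {a i..b i} x)" if "x \<in> space Rplus" for x
  proof (cases "f x = 0")
    case True
    then show ?thesis using h by (auto intro!: sum_nonneg)
  next
    case False
    then obtain i where i: "i \<in> I" "x \<in> {a i..b i}" "(norm (f x))\<^sup>2 \<le> h i"
      using out \<open>x \<in> space Rplus\<close> by (auto simp: space_Rplus)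
    have "h i * indicator {a i..b i} x \<le> (\<Sum>i\<in>I. h i * indicator {a i..b i} x)"
      using i h \<open>finite I\<close> by (intro member_le_sum) auto
    then show ?thesis using i by simp
  qed
  have i: "integrable Rplus (\<lambda>x. (norm (f x))\<^sup>2)"
    by (rule Bochner_Integration.integrable_bound[OF step_integral(1)[of I a b h, OF ab]])
      (use le in \<open>auto intro!: AE_I2 order.trans[OF _ abs_ge_self]\<close>)
  then show "f \<in> L2" by (simp add: L2_def)
  show "(L2_norm f)\<^sup>2 \<le> (\<Sum>i\<in>I. h i * (b i - a i))"
  proof -
    have "(LINT x|Rplus. (norm (f x))\<^sup>2) \<le> (LINT x|Rplus. (\<Sum>i\<in>I. h i * indicator {a i..b i} x))"
      by (rule integral_mono[OF i step_integral(1)[OF ab] le])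
    also have "\<dots> = (\<Sum>i\<in>I. h i * (b i - a i))" by (rule step_integral(2)[OF ab])
    finally show ?thesis by (simp add: L2_norm_sq)
  qed
qed

lemma L2_norm_ge_step:
  fixes a b h :: "'i \<Rightarrow> real"
  assumes "finite I" and ab: "\<And>i. i \<in> I \<Longrightarrow> 0 < a i \<and> a i \<le> b i"
    and disj: "disjoint_family_on (\<lambda>i. {a i..b i}) I"
    and f: "f \<in> L2"
    and ge: "AE x in Rplus. \<forall>i\<in>I. x \<in> {a i..b i} \<longrightarrow> h i \<le> (norm (f x))\<^sup>2"
  shows "(\<Sum>i\<in>I. h i * (b i - a i)) \<le> (L2_norm f)\<^sup>2"
proof -
  have "(LINT x|Rplus. (\<Sum>i\<in>I. h i * indicator {a i..b i} x)) \<le> (LINT x|Rplus. (norm (f x))\<^sup>2)"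
  proof (rule integral_mono_AE[OF step_integral(1)[OF ab]])
    show "integrable Rplus (\<lambda>x. (norm (f x))\<^sup>2)" using f by (simp add: L2_def)
    show "AE x in Rplus. (\<Sum>i\<in>I. h i * indicator {a i..b i} x) \<le> (norm (f x))\<^sup>2"
      using ge
    proof eventually_elim
      case (elim x)
      show ?case
      proof (cases "\<exists>i\<in>I. x \<in> {a i..b i}")
        case True
        then obtain i where i: "i \<in> I" "x \<in> {a i..b i}" by blast
        have "(\<Sum>k\<in>I. h k * indicator {a k..b k} x) = (\<Sum>k\<in>I. if k = i then h i else 0)"
        proof (rule sum.cong)
          fix k assume "k \<in> I"
          show "h k * indicator {a k..b k} x = (if k = i then h i else 0)"
            using disjoint_family_onD[OF disj \<open>k \<in> I\<close> i(1)] i(2) by (auto simp: indicator_def)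
        qed simp
        also have "\<dots> = h i" using i \<open>finite I\<close> by simp
        finally show ?thesis using elim i by auto
      next
        case False
        then have "(\<Sum>k\<in>I. h k * indicator {a k..b k} x) = 0"
          by (intro sum.neutral) (auto simp: indicator_def)
        then show ?thesis by simp
      qed
    qed
  qed
  also have "(LINT x|Rplus. (\<Sum>i\<in>I. h i * indicator {a i..b i} x)) = (\<Sum>i\<in>I. h i * (b i - a i))"
    by (rule step_integral(2)[OF ab])
  finally show ?thesis by (simp add: L2_norm_sq)
qed

text \<open>
  A homogeneous linear system with more unknowns than equations, by Gaussian elimination: an equation
  with a nonzero coefficient at some \<open>p\<close> is solved for the unknown \<open>z p\<close>, which removes one equation and
  one unknown.
\<close>

lemma homogeneous_system_nontrivial:
  fixes c :: "'i \<Rightarrow> 'g \<Rightarrow> 'f::field"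
  assumes "finite B" "finite I" "card B < card I"
  shows "\<exists>z. (\<exists>i\<in>I. z i \<noteq> 0) \<and> (\<forall>g\<in>B. (\<Sum>i\<in>I. z i * c i g) = 0)"
  using assms
proof (induction B arbitrary: I c rule: finite_induct)
  case empty
  then obtain i where "i \<in> I" by (metis card.empty ex_in_conv less_irrefl)
  then show ?case by (intro exI[of _ "\<lambda>_. 1"]) auto
next
  case (insert g B)
  show ?case
  proof (cases "\<forall>i\<in>I. c i g = 0")
    case True
    then show ?thesis using insert.IH[of I c] insert.prems insert.hyps by auto
  next
    case False
    then obtain p where p: "p \<in> I" "c p g \<noteq> 0" by blast
    define c' where "c' i h = c i h - c i g / c p g * c p h" for i h
    have "card B < card (I - {p})" using p insert by auto
    from insert.IH[OF _ this, of c'] insert.prems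
    obtain z where z: "\<exists>i\<in>I-{p}. z i \<noteq> 0" "\<And>h. h \<in> B \<Longrightarrow> (\<Sum>i\<in>I-{p}. z i * c' i h) = 0"
      by auto
    \<comment> \<open>The pivot unknown is determined by the equation \<open>g\<close>.\<close>
    define z' where "z' = z(p := - (\<Sum>i\<in>I-{p}. z i * c i g) / c p g)"
    have sp: "(\<Sum>i\<in>I. z' i * c i h) = z' p * c p h + (\<Sum>i\<in>I-{p}. z i * c i h)" for h
      using insert.prems p by (subst sum.remove[of _ p]) (auto simp: z'_def intro!: sum.cong)
    have "(\<Sum>i\<in>I. z' i * c i h) = 0" if "h \<in> insert g B" for h
    proof (cases "h = g")
      case True
      then show ?thesis unfolding sp using p by (simp add: z'_def)
    next
      case False
      then have "0 = (\<Sum>i\<in>I-{p}. z i * c' i h)" using z that by auto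
      also have "\<dots> = (\<Sum>i\<in>I-{p}. z i * c i h) - (\<Sum>i\<in>I-{p}. z i * c i g) / c p g * c p h"
        by (simp add: c'_def algebra_simps sum_subtractf sum_distrib_left sum_divide_distrib)
      finally show ?thesis unfolding sp by (simp add: z'_def)
    qed
    moreover have "\<exists>i\<in>I. z' i \<noteq> 0" using z(1) by (auto simp: z'_def)
    ultimately show ?thesis by blast
  qed
qed

lemma bounded_opD:
  assumes "bounded_op T"
  shows "\<And>f. f \<in> L2 \<Longrightarrow> T f \<in> L2"
    "\<And>f g. f \<in> L2 \<Longrightarrow> g \<in> L2 \<Longrightarrow> AE x in Rplus. T (\<lambda>y. f y + g y) x = T f x + T g x"
    "\<And>f c. f \<in> L2 \<Longrightarrow> AE x in Rplus. T (\<lambda>y. c * f y) x = c * T f x"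
  using assms by (auto simp: bounded_op_def)

lemma bounded_opE:
  assumes "bounded_op T"
  obtains C where "C \<ge> 0" "\<And>f. f \<in> L2 \<Longrightarrow> L2_norm (T f) \<le> C * L2_norm f"
proof -
  obtain C where C: "\<And>f. f \<in> L2 \<Longrightarrow> L2_norm (T f) \<le> C * L2_norm f"
    using assms unfolding bounded_op_def by blast
  show ?thesis
    by (rule that[of "max C 0"]) (use C in \<open>auto intro: order.trans[OF C mult_right_mono]\<close>)
qed

lemma bounded_op_sum:
  assumes T: "bounded_op T" and "finite I" and e: "\<And>i. i \<in> I \<Longrightarrow> e i \<in> L2"
  shows "AE x in Rplus. T (\<lambda>y. \<Sum>i\<in>I. z i * e i y) x = (\<Sum>i\<in>I. z i * T (e i) x)"
  using \<open>finite I\<close> e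
proof (induction I rule: finite_induct)
  case empty
  then show ?case using bounded_opD(3)[OF T L2_zero, of 0] by simp
next
  case (insert i I)
  have ei: "e i \<in> L2" using insert.prems by auto
  have s: "(\<lambda>y. \<Sum>i\<in>I. z i * e i y) \<in> L2" using insert.prems by (intro L2_sum L2_scale) auto
  have "AE x in Rplus. T (\<lambda>y. \<Sum>i\<in>I. z i * e i y) x = (\<Sum>i\<in>I. z i * T (e i) x)"
    using insert by auto
  with bounded_opD(2)[OF T L2_scale(1)[OF ei, of "z i"] s] bounded_opD(3)[OF T ei, of "z i"]
  show ?case by eventually_elim (use insert.hyps in simp)
qed

text \<open>
  The supremum defining \<open>op_norm\<close> is only meaningful once the set is known to be bounded; that is
  where boundedness of both operators enters. Homogeneity holds almost everywhere only, so the
  normalisation of \<open>f\<close> passes through \<open>L2_norm_cong_AE\<close>.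
\<close>

lemma op_norm_diff_bound:
  assumes T: "bounded_op T" and K: "bounded_op K" and f: "f \<in> L2"
  shows "L2_norm (\<lambda>x. T f x - K f x) \<le> op_norm (\<lambda>f x. T f x - K f x) * L2_norm f"
proof -
  obtain C where C: "C \<ge> 0" "\<And>f. f \<in> L2 \<Longrightarrow> L2_norm (T f) \<le> C * L2_norm f" using bounded_opE[OF T] by blast
  obtain D where D: "D \<ge> 0" "\<And>f. f \<in> L2 \<Longrightarrow> L2_norm (K f) \<le> D * L2_norm f" using bounded_opE[OF K] by blast
  have S: "(L2_norm (\<lambda>x. T g x - K g x))\<^sup>2 \<le> (2 * C\<^sup>2 + 2 * D\<^sup>2) * (L2_norm g)\<^sup>2" if g: "g \<in> L2" for g
  proof -
    have "(L2_norm (\<lambda>x. T g x - K g x))\<^sup>2 \<le> 2 * (L2_norm (T g))\<^sup>2 + 2 * (L2_norm (K g))\<^sup>2"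
      by (intro L2_diff bounded_opD(1)[OF T] bounded_opD(1)[OF K] g)
    also have "\<dots> \<le> 2 * (C * L2_norm g)\<^sup>2 + 2 * (D * L2_norm g)\<^sup>2"
      using C D g by (intro add_mono mult_left_mono power_mono) auto
    finally show ?thesis by (simp add: power_mult_distrib algebra_simps)
  qed
  show ?thesis
  proof (cases "L2_norm f = 0")
    case True
    then show ?thesis using S[OF f] by simp
  next
    case False
    define n where "n = L2_norm f"
    have n: "n > 0" using False L2_norm_nonneg[of f] by (auto simp: n_def less_le)
    define g where "g = (\<lambda>x. of_real (1 / n) * f x)"
    have g: "g \<in> L2" "L2_norm g = 1"
      using n L2_scale[OF f, of "of_real (1 / n)"] by (simp_all add: g_def n_def norm_divide)
    have "L2_norm (\<lambda>x. T g x - K g x) = L2_norm (\<lambda>x. of_real (1 / n) * (T f x - K f x))"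
    proof (rule L2_norm_cong_AE)
      show "AE x in Rplus. T g x - K g x = of_real (1 / n) * (T f x - K f x)"
        using bounded_opD(3)[OF T f, of "of_real (1 / n)"] bounded_opD(3)[OF K f, of "of_real (1 / n)"]
        unfolding g_def by eventually_elim (simp add: algebra_simps)
    qed (intro L2_diff L2_scale bounded_opD(1)[OF T] bounded_opD(1)[OF K] f g)+
    also have "\<dots> = L2_norm (\<lambda>x. T f x - K f x) / n"
      using n by (subst L2_scale(2)) (auto simp: norm_divide intro!: L2_diff bounded_opD(1)[OF T] bounded_opD(1)[OF K] f)
    finally have eq: "L2_norm (\<lambda>x. T f x - K f x) / n = L2_norm (\<lambda>x. T g x - K g x)" ..
    have "L2_norm (\<lambda>x. T g x - K g x) \<le> op_norm (\<lambda>f x. T f x - K f x)"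
      unfolding op_norm_def
    proof (rule cSUP_upper)
      show "bdd_above ((\<lambda>f. L2_norm (\<lambda>x. T f x - K f x)) ` {f \<in> L2. L2_norm f \<le> 1})"
      proof (rule bdd_aboveI2)
        fix h assume h: "h \<in> {f \<in> L2. L2_norm f \<le> 1}"
        have "(L2_norm h)\<^sup>2 \<le> 1" using h by (simp add: power_le_one)
        then have "(2 * C\<^sup>2 + 2 * D\<^sup>2) * (L2_norm h)\<^sup>2 \<le> (2 * C\<^sup>2 + 2 * D\<^sup>2)"
          by (intro mult_left_le) auto
        then have "(L2_norm (\<lambda>x. T h x - K h x))\<^sup>2 \<le> 2 * C\<^sup>2 + 2 * D\<^sup>2" using S[of h] h by auto
        then show "L2_norm (\<lambda>x. T h x - K h x) \<le> sqrt (2 * C\<^sup>2 + 2 * D\<^sup>2)"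
          by (rule real_le_rsqrt)
      qed
    qed (use g in auto)
    then show ?thesis using n unfolding eq[symmetric] by (simp add: field_simps n_def)
  qed
qed

text \<open>
  An operator \<open>K\<close> of rank at most \<open>j\<close> maps the \<open>j + 1\<close> functions \<open>e i\<close> into a space spanned by \<open>j\<close>
  functions, hence kills a nontrivial combination \<open>f\<close> of them. Then \<open>(T - K) f = T f\<close>, and the distance
  of \<open>K\<close> from \<open>T\<close> is at least \<open>\<kappa>\<close>. The hypothesis that \<open>T f\<close> has positive norm guarantees, by boundedness of \<open>T\<close>,
  that the norm of \<open>f\<close> is positive and may be cancelled.
\<close>

lemma sing_val_ge:
  assumes T: "bounded_op T" and e: "\<And>i. i \<le> j \<Longrightarrow> e i \<in> L2"
    and lower: "\<And>z. \<kappa> * L2_norm (\<lambda>y. \<Sum>i\<le>j. z i * e i y) \<le> L2_norm (T (\<lambda>y. \<Sum>i\<le>j. z i * e i y))"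
    and inj: "\<And>z. \<exists>i\<le>j. z i \<noteq> 0 \<Longrightarrow> 0 < L2_norm (T (\<lambda>y. \<Sum>i\<le>j. z i * e i y))"
  shows "\<kappa> \<le> sing_val T j"
  unfolding sing_val_def
proof (rule cINF_greatest)
  have "rank_le (\<lambda>f x. 0) j"
    unfolding rank_le_def by (rule exI[of _ "{}"]) auto
  moreover have "bounded_op (\<lambda>f x. 0)"
    unfolding bounded_op_def by (auto simp: L2_zero L2_norm_def intro!: exI[of _ 0])
  ultimately show "{K. bounded_op K \<and> rank_le K j} \<noteq> {}" by blast
next
  fix K assume "K \<in> {K. bounded_op K \<and> rank_le K j}"
  then have K: "bounded_op K" and "rank_le K j" by auto
  then obtain B where B: "finite B" "card B \<le> j" "\<And>f. f \<in> L2 \<Longrightarrow> \<exists>c. AE x in Rplus. K f x = (\<Sum>g\<in>B. c g * g x)"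
    unfolding rank_le_def by blast
  then have "\<forall>i\<in>{..j}. \<exists>c. AE x in Rplus. K (e i) x = (\<Sum>g\<in>B. c g * g x)" using e by auto
  from bchoice[OF this]
  obtain c where c: "\<And>i. i \<le> j \<Longrightarrow> AE x in Rplus. K (e i) x = (\<Sum>g\<in>B. c i g * g x)"
    by auto
  obtain z where z: "\<exists>i\<le>j. z i \<noteq> 0" "\<And>g. g \<in> B \<Longrightarrow> (\<Sum>i\<le>j. z i * c i g) = 0"
    using homogeneous_system_nontrivial[of B "{..j}" c] B by auto
  define f where "f = (\<lambda>y. \<Sum>i\<le>j. z i * e i y)"
  have f: "f \<in> L2" unfolding f_def by (intro L2_sum L2_scale e) auto
  have "AE x in Rplus. \<forall>i\<in>{..j}. K (e i) x = (\<Sum>g\<in>B. c i g * g x)"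
    by (rule AE_finite_allI) (use c in auto)
  moreover have "AE x in Rplus. K f x = (\<Sum>i\<le>j. z i * K (e i) x)"
    unfolding f_def by (rule bounded_op_sum[OF K]) (use e in auto)
  ultimately have Kf: "AE x in Rplus. K f x = 0"
  proof eventually_elim
    case (elim x)
    have "K f x = (\<Sum>i\<le>j. z i * (\<Sum>g\<in>B. c i g * g x))" using elim by simp
    also have "\<dots> = (\<Sum>i\<le>j. \<Sum>g\<in>B. z i * c i g * g x)" by (simp add: sum_distrib_left mult_ac)
    also have "\<dots> = (\<Sum>g\<in>B. (\<Sum>i\<le>j. z i * c i g) * g x)" by (subst sum.swap) (simp add: sum_distrib_right)
    also have "\<dots> = 0" using z by simp
    finally show ?case .
  qed
  have "L2_norm (\<lambda>x. T f x - K f x) = L2_norm (T f)"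
  proof (rule L2_norm_cong_AE)
    show "AE x in Rplus. T f x - K f x = T f x" using Kf by eventually_elim simp
  qed (intro L2_diff bounded_opD(1)[OF T] bounded_opD(1)[OF K] f)+
  with op_norm_diff_bound[OF T K f] lower[of z, folded f_def]
  have *: "\<kappa> * L2_norm f \<le> op_norm (\<lambda>f x. T f x - K f x) * L2_norm f"
    by linarith
  obtain C where "\<And>f. f \<in> L2 \<Longrightarrow> L2_norm (T f) \<le> C * L2_norm f" using bounded_opE[OF T] by blast
  from this[OF f] inj[OF z(1), folded f_def] have "0 < C * L2_norm f" by linarith
  then have "L2_norm f \<noteq> 0" by auto
  then have "0 < L2_norm f" using L2_norm_nonneg[of f] by linarith
  with * show "\<kappa> \<le> op_norm (\<lambda>f x. T f x - K f x)" by simp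
qed

section \<open>Hankel operators acting on bumps\<close>

text \<open>
  Up to the phase \<open>z\<close> the integrand is nonnegative, so that there is no cancellation and any step function
  below it bounds the value of the operator from below.
\<close>

lemma hankel_lower:
  fixes G m c d :: "_ \<Rightarrow> real"
  assumes f: "f \<in> test_functions" and x: "x > 0" and a: "a > 0"
    and G: "\<And>y. y > 0 \<Longrightarrow> \<psi> (x + y) * f y = z * of_real (G y)"
      "continuous_on {a..b} G" "\<And>y. y \<notin> {a..b} \<Longrightarrow> G y = 0"
    and I: "\<And>i. i \<in> I \<Longrightarrow> 0 < c i \<and> c i \<le> d i"
    and le: "\<And>y. y > 0 \<Longrightarrow> (\<Sum>i\<in>I. m i * indicator {c i..d i} y) \<le> x powr \<alpha> * y powr \<beta> * G y"
  shows "norm z * (\<Sum>i\<in>I. m i * (d i - c i)) \<le> norm (hankel \<alpha> \<beta> (regular_dist \<psi>) f x)"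
proof -
  define k where "k y = x powr \<alpha> * y powr \<beta> * G y" for y
  have "continuous_on {a..b} k" unfolding k_def
    using a by (intro continuous_intros G(2)) auto
  then have "set_integrable lborel {a..b} k" by (rule borel_integrable_atLeastAtMost')
  moreover have "indicator {a..b} y * k y = indicator {0<..} y * k y" for y
    using G(3)[of y] a by (auto simp: indicator_def k_def)
  ultimately have k: "integrable Rplus k"
    by (subst integrable_restrict_space) (simp_all add: set_integrable_def)
  have "hankel \<alpha> \<beta> (regular_dist \<psi>) f x =
      (LBINT y:{0<..}. of_real (x powr \<alpha> * y powr \<beta>) * \<psi> (x + y) * f y)"
    by (rule hankel_regular_dist[OF f x])
  also have "\<dots> = (LBINT y:{0<..}. z * of_real (k y))"
  proof (rule set_lebesgue_integral_cong)
    show "\<forall>y. y \<in> {0<..} \<longrightarrow> of_real (x powr \<alpha> * y powr \<beta>) * \<psi> (x + y) * f y = z * of_real (k y)"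
      using G(1) by (simp add: k_def mult.assoc)
  qed simp
  also have "\<dots> = z * of_real (LINT y|Rplus. k y)"
  proof -
    have "(LBINT y:{0<..}. z * of_real (k y)) = (LBINT y. z * of_real (indicator {0<..} y *\<^sub>R k y))"
      unfolding set_lebesgue_integral_def
      by (rule Bochner_Integration.integral_cong) (auto simp: indicator_def)
    also have "\<dots> = z * of_real (LBINT y. indicator {0<..} y *\<^sub>R k y)"
      by (simp only: integral_mult_right_zero integral_complex_of_real)
    finally show ?thesis by (simp only: integral_restrict_space[OF Rplus_sets])
  qed
  finally have eq: "norm (hankel \<alpha> \<beta> (regular_dist \<psi>) f x) = norm z * \<bar>LINT y|Rplus. k y\<bar>"
    by (simp add: norm_mult)
  have "(\<Sum>i\<in>I. m i * (d i - c i)) = (LINT y|Rplus. (\<Sum>i\<in>I. m i * indicator {c i..d i} y))"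
    by (rule step_integral(2)[symmetric, OF I])
  also have "\<dots> \<le> (LINT y|Rplus. k y)"
    by (rule integral_mono[OF step_integral(1)[OF I] k]) (use le in \<open>auto simp: space_Rplus k_def\<close>)
  finally show ?thesis unfolding eq by (intro mult_left_mono) auto
qed

lemma mem_interval_abs: "t \<in> {c - r..c + r} \<longleftrightarrow> \<bar>t - c\<bar> \<le> r" for t c r :: real
  by (simp add: abs_le_iff) linarith

text \<open>
  At distances comparable to \<open>u\<close> a power weight is comparable to \<open>u\<^sup>\<gamma>\<close>; the constant covers both signs of the
  exponent.
\<close>

lemma powr_ge_scale:
  fixes t u :: real
  assumes "u > 0" "u / 2 \<le> t" "t \<le> 2 * u"
  shows "2 powr (- \<bar>\<gamma>\<bar>) * u powr \<gamma> \<le> t powr \<gamma>"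
proof (cases "\<gamma> \<ge> 0")
  case True
  have "2 powr (- \<bar>\<gamma>\<bar>) * u powr \<gamma> = (u / 2) powr \<gamma>"
    using True assms powr_divide[of u 2 \<gamma>] by (simp add: powr_minus_divide)
  also have "\<dots> \<le> t powr \<gamma>" using True assms by (intro powr_mono2) auto
  finally show ?thesis .
next
  case False
  have "2 powr (- \<bar>\<gamma>\<bar>) * u powr \<gamma> = (2 * u) powr \<gamma>"
    using False assms by (simp add: powr_mult)
  also have "\<dots> \<le> t powr \<gamma>" using False assms by (intro powr_mono2') auto
  finally show ?thesis .
qed

text \<open>
  A fixed nonnegative profile, at least \<open>1\<close> on \<open>[-1, 1]\<close> and supported in \<open>[-L, L]\<close>. All symbols and all
  test functions below are translates and dilates of it.
\<close>

locale bump =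
  fixes \<eta> :: "real \<Rightarrow> real" and L B :: real
  assumes L: "L \<ge> 1" and smooth_bump: "smooth (\<lambda>t. of_real (\<eta> t))"
    and bump_nonneg: "\<And>t. 0 \<le> \<eta> t" and bump_le: "\<And>t. \<eta> t \<le> B"
    and bump_ge: "\<And>t. \<bar>t\<bar> \<le> 1 \<Longrightarrow> 1 \<le> \<eta> t"
    and bump_zero: "\<And>t. L < \<bar>t\<bar> \<Longrightarrow> \<eta> t = 0"
begin

definition bump_at :: "real \<Rightarrow> real \<Rightarrow> real \<Rightarrow> real" where
  "bump_at c w t = \<eta> ((t - c) / w)"

lemma B_ge: "B \<ge> 1"
  using bump_ge[of 0] bump_le[of 0] by simp

lemma bump_at_nonneg [simp]: "0 \<le> bump_at c w t" and bump_at_le [simp]: "bump_at c w t \<le> B"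
  by (simp_all add: bump_at_def bump_nonneg bump_le)

lemma bump_at_ge: "w > 0 \<Longrightarrow> \<bar>t - c\<bar> \<le> w \<Longrightarrow> 1 \<le> bump_at c w t"
  unfolding bump_at_def by (intro bump_ge) simp

lemma bump_at_zero: "w > 0 \<Longrightarrow> L * w < \<bar>t - c\<bar> \<Longrightarrow> bump_at c w t = 0"
  unfolding bump_at_def by (intro bump_zero) (simp add: field_simps)

lemma bump_at_supp: "w > 0 \<Longrightarrow> bump_at c w t \<noteq> 0 \<Longrightarrow> \<bar>t - c\<bar> \<le> L * w"
  by (rule ccontr) (simp add: bump_at_zero)

lemma bump_at_outside: "w > 0 \<Longrightarrow> t \<notin> {c - L * w..c + L * w} \<Longrightarrow> bump_at c w t = 0"
  unfolding mem_interval_abs by (rule bump_at_zero) auto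

lemma smooth_bump_at: "smooth (\<lambda>t. of_real (bump_at c w t))"
  using smooth_affine[OF smooth_bump, of "1/w" "- c/w"]
  by (simp add: bump_at_def diff_divide_distrib)

lemma bump_at_test:
  assumes "w > 0" "L * w < c"
  shows "(\<lambda>t. of_real (bump_at c w t)) \<in> test_functions"
  by (rule test_functionI[of _ "c - L * w" "c + L * w", OF smooth_bump_at])
    (use assms in \<open>auto simp: abs_if intro!: bump_at_zero\<close>)

lemma continuous_bump_at: "continuous_on A (bump_at c w)"
  using continuous_on_Re[OF smooth_continuous[OF smooth_bump_at, of A c w]] by simp

lemma bump_at_L2:
  assumes "w > 0" "L * w < c"
  shows "(\<lambda>t. complex_of_real (bump_at c w t)) \<in> L2"
proof (rule L2_norm_le_step(1)[of "{()}" "\<lambda>_. c - L * w" "\<lambda>_. c + L * w" "\<lambda>_. B\<^sup>2"])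
  show "(\<lambda>t. complex_of_real (bump_at c w t)) \<in> borel_measurable borel"
    by (rule smooth_borel_measurable[OF smooth_bump_at])
  show "\<exists>i\<in>{()}. x \<in> {c - L * w..c + L * w} \<and> (norm (complex_of_real (bump_at c w x)))\<^sup>2 \<le> B\<^sup>2"
    if "complex_of_real (bump_at c w x) \<noteq> 0" for x
  proof -
    have "\<bar>x - c\<bar> \<le> L * w" using that bump_at_supp[OF assms(1)] by simp
    then show ?thesis using bump_at_nonneg bump_at_le by (auto intro!: power_mono simp: abs_le_iff)
  qed
qed (use assms L in auto)

text \<open>
  The symbol is, where it matters, a bump of height \<open>a\<close> and width \<open>w\<close> at \<open>c\<close>; the points \<open>x i\<close> and \<open>y i\<close> are
  mirror images with respect to \<open>c/2\<close>. The test function \<open>e i\<close> is a bump at \<open>y i\<close> of the same width, and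
  its image lives within \<open>2 L w\<close> of \<open>x i\<close>. Points \<open>5 L w\<close> apart thus make the test functions disjointly
  supported, and near \<open>x i\<close> only \<open>e i\<close> contributes to the image of a combination. On this span the operator is
  bounded below as if it were diagonal, with entries of order \<open>\<kappa> a w\<close>.
\<close>

lemma sing_val_narrow_ge:
  fixes x y :: "nat \<Rightarrow> real"
  assumes T: "bounded_op T"
    and agree: "\<And>f. f \<in> test_functions \<Longrightarrow> AE s in Rplus. T f s = hankel \<alpha> \<beta> (regular_dist \<psi>) f s"
    and w: "w > 0" and a: "a > 0" and \<kappa>: "\<kappa> > 0"
    and sep: "\<And>i k. i \<le> j \<Longrightarrow> k \<le> j \<Longrightarrow> i \<noteq> k \<Longrightarrow> 5 * (L * w) \<le> \<bar>x i - x k\<bar>"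
    and sum_c: "\<And>i. i \<le> j \<Longrightarrow> x i + y i = c"
    and pos: "\<And>i. i \<le> j \<Longrightarrow> 5 * (L * w) \<le> x i \<and> 5 * (L * w) \<le> y i"
    and \<psi>: "\<And>i k s. i \<le> j \<Longrightarrow> k \<le> j \<Longrightarrow> \<bar>s\<bar> \<le> 2 * (L * w) \<Longrightarrow>
      \<psi> (x i + y k + s) = of_real (a * bump_at c w (x i + y k + s))"
    and weight: "\<And>i s t. i \<le> j \<Longrightarrow> \<bar>s - x i\<bar> \<le> w / 2 \<Longrightarrow> \<bar>t - y i\<bar> \<le> w / 2 \<Longrightarrow>
      \<kappa> \<le> s powr \<alpha> * t powr \<beta>"
  shows "\<kappa> * a * w / (B * sqrt (2 * L)) \<le> sing_val T j"
proof -
  define e where "e i t = complex_of_real (bump_at (y i) w t)" for i t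
  have Lw: "w \<le> L * w" "0 < L * w" using L w by auto
  have e_test: "e i \<in> test_functions" and e_L2: "e i \<in> L2" if "i \<le> j" for i
    unfolding e_def[abs_def] using pos[OF that] Lw
    by (auto intro!: bump_at_test bump_at_L2 w)
  \<comment> \<open>The combination with coefficients \<open>z\<close>; in the pointwise bound below only the coefficient \<open>z i\<close> is seen near \<open>x i\<close>.\<close>
  define f where "f z t = (\<Sum>i\<le>j. z i * e i t)" for z t
  have f_test: "f z \<in> test_functions" for z
    unfolding f_def[abs_def] by (intro test_functions_sum test_functions_scale e_test) auto
  have f_L2: "f z \<in> L2" for z
    unfolding f_def[abs_def] by (intro L2_sum L2_scale e_L2) auto
  have e_nz: "\<bar>t - y i\<bar> \<le> L * w" if "e i t \<noteq> 0" for i t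
    using that bump_at_supp[OF w] by (simp add: e_def)
  have point: "(norm (z i) * (\<kappa> * a * w))\<^sup>2 \<le> (norm (hankel \<alpha> \<beta> (regular_dist \<psi>) (f z) s))\<^sup>2"
    if i: "i \<le> j" and s: "\<bar>s - x i\<bar> \<le> w / 2" for z i s
  proof -
    have s0: "s > 0" using s pos[OF i] Lw w by linarith
    define G where "G t = a * bump_at c w (s + t) * bump_at (y i) w t" for t
    have "norm (z i) * (\<Sum>u\<in>{()}. \<kappa> * a * ((y i + w/2) - (y i - w/2)))
        \<le> norm (hankel \<alpha> \<beta> (regular_dist \<psi>) (f z) s)"
    proof (rule hankel_lower[OF f_test s0, where G = G and a = "y i - L * w" and b = "y i + L * w"])
      show "0 < y i - L * w" using pos[OF i] Lw by auto
      show "\<psi> (s + t) * f z t = z i * of_real (G t)" for t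
      proof -
        have "\<psi> (s + t) * (z k * e k t) = (if k = i then z i * of_real (G t) else 0)" if k: "k \<le> j" for k
        proof (cases "e k t = 0")
          case True
          then show ?thesis by (auto simp: G_def e_def)
        next
          case False
          define r where "r = s - x i + (t - y k)"
          have r: "\<bar>r\<bar> \<le> 2 * (L * w)"
            using e_nz[OF False] s Lw w unfolding r_def by linarith
          have st: "s + t = x i + y k + r" by (simp add: r_def)
          have psi: "\<psi> (s + t) = of_real (a * bump_at c w (s + t))"
            unfolding st by (rule \<psi>[OF i k r])
          show ?thesis
          proof (cases "k = i")
            case True
            then show ?thesis by (simp add: psi G_def e_def)
          next
            case False
            have "x i + y k + r - c = x i - x k + r" using sum_c[OF k] by simp
            then have "L * w < \<bar>s + t - c\<bar>"
              using r sep[OF i k] False Lw unfolding st by linarith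
            then show ?thesis using False by (simp add: psi bump_at_zero[OF w])
          qed
        qed
        then have "\<psi> (s + t) * f z t = (\<Sum>k\<le>j. if k = i then z i * of_real (G t) else 0)"
          unfolding f_def sum_distrib_left by (intro sum.cong) auto
        then show ?thesis using i by simp
      qed
      show "continuous_on {y i - L * w..y i + L * w} G"
        unfolding G_def
        by (intro continuous_intros continuous_bump_at continuous_on_compose2[OF continuous_bump_at[of UNIV]]) auto
      show "G t = 0" if "t \<notin> {y i - L * w..y i + L * w}" for t
        using bump_at_outside[OF w that] by (simp add: G_def)
      show "0 < y i - w/2 \<and> y i - w/2 \<le> y i + w/2" for u :: unit
        using pos[OF i] Lw w by (intro conjI; linarith)
      show "(\<Sum>u\<in>{()}. \<kappa> * a * indicator {y i - w/2..y i + w/2} t) \<le> s powr \<alpha> * t powr \<beta> * G t" for t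
      proof (cases "t \<in> {y i - w/2..y i + w/2}")
        case True
        then have t: "\<bar>t - y i\<bar> \<le> w / 2" unfolding mem_interval_abs .
        have "\<bar>s + t - c\<bar> \<le> w" using s t sum_c[OF i] by linarith
        then have "1 * 1 \<le> bump_at c w (s + t) * bump_at (y i) w t"
          using t w by (intro mult_mono bump_at_ge) auto
        then have "a * 1 \<le> G t" unfolding G_def mult.assoc using a by (intro mult_left_mono) auto
        then have "\<kappa> * (a * 1) \<le> s powr \<alpha> * t powr \<beta> * G t"
          using weight[OF i s t] a \<kappa> by (intro mult_mono) auto
        then show ?thesis using True by simp
      next
        case False
        have "0 \<le> G t" unfolding G_def using a by (intro mult_nonneg_nonneg bump_at_nonneg) auto
        then show ?thesis using False by simp
      qed
    qed
    then show ?thesis using \<kappa> a w by (intro power_mono) auto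
  qed
  define S where "S z = (\<Sum>i\<le>j. (norm (z i))\<^sup>2)" for z :: "nat \<Rightarrow> complex"
  have lowerT: "(\<kappa> * a * w)\<^sup>2 * w * S z \<le> (L2_norm (T (f z)))\<^sup>2" for z
  proof -
    have "(\<Sum>i\<in>{..j}. (norm (z i) * (\<kappa> * a * w))\<^sup>2 * ((x i + w/2) - (x i - w/2))) \<le> (L2_norm (T (f z)))\<^sup>2"
    proof (rule L2_norm_ge_step)
      show "0 < x i - w/2 \<and> x i - w/2 \<le> x i + w/2" if "i \<in> {..j}" for i
        using pos[of i, OF that[unfolded atMost_iff]] Lw w by (intro conjI; linarith)
      show "disjoint_family_on (\<lambda>i. {x i - w/2..x i + w/2}) {..j}"
        unfolding disjoint_family_on_def
      proof safe
        fix i k t assume "i \<le> j" "k \<le> j" "i \<noteq> k" and t: "t \<in> {x i - w/2..x i + w/2}" "t \<in> {x k - w/2..x k + w/2}"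
        then have "5 * (L * w) \<le> \<bar>x i - x k\<bar>" using sep by blast
        moreover have "\<bar>x i - x k\<bar> \<le> w" using t by (auto simp: abs_le_iff)
        ultimately have False using Lw w by linarith
        then show "t \<in> {}" ..
      qed
      show "T (f z) \<in> L2" by (rule bounded_opD(1)[OF T f_L2])
      show "AE s in Rplus. \<forall>i\<in>{..j}. s \<in> {x i - w/2..x i + w/2} \<longrightarrow>
          (norm (z i) * (\<kappa> * a * w))\<^sup>2 \<le> (norm (T (f z) s))\<^sup>2"
        using agree[OF f_test[of z]]
        by eventually_elim (simp add: mem_interval_abs point del: atLeastAtMost_iff)
    qed simp
    then show ?thesis
      by (simp add: S_def power_mult_distrib sum_distrib_left mult_ac)
  qed
  have upperf: "(L2_norm (f z))\<^sup>2 \<le> B\<^sup>2 * (2 * L * w) * S z" for z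
  proof -
    have "(L2_norm (f z))\<^sup>2 \<le> (\<Sum>i\<in>{..j}. (norm (z i) * B)\<^sup>2 * ((y i + L * w) - (y i - L * w)))"
    proof (rule L2_norm_le_step(2))
      show "0 < y i - L * w \<and> y i - L * w \<le> y i + L * w" if "i \<in> {..j}" for i
        using pos[of i, OF that[unfolded atMost_iff]] Lw w by (intro conjI; linarith)
      show "f z \<in> borel_measurable borel"
        using f_test[of z] by (auto simp: test_functions_def intro: smooth_borel_measurable)
      fix t assume "f z t \<noteq> 0"
      then have "(\<Sum>i\<le>j. z i * e i t) \<noteq> 0" by (simp add: f_def)
      then obtain i where "i \<in> {..j}" "z i * e i t \<noteq> 0"
        by (rule sum.not_neutral_contains_not_neutral)
      then have i: "i \<le> j" "e i t \<noteq> 0" by auto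
      have "e k t = 0" if k: "k \<le> j" "k \<noteq> i" for k
      proof (rule ccontr)
        assume "e k t \<noteq> 0"
        then have "\<bar>y i - y k\<bar> \<le> 2 * (L * w)" using e_nz[OF i(2)] e_nz[of k t] by linarith
        moreover have "y i - y k = x k - x i" using sum_c[OF i(1)] sum_c[OF k(1)] by linarith
        ultimately show False using sep[OF i(1) k(1)] k(2) Lw by linarith
      qed
      then have "f z t = (\<Sum>k\<le>j. if k = i then z i * e i t else 0)"
        unfolding f_def by (intro sum.cong) auto
      then have ft: "f z t = z i * e i t" using i by simp
      have "norm (e i t) \<le> B" using bump_at_nonneg bump_at_le by (auto simp: e_def)
      then have "(norm (f z t))\<^sup>2 \<le> (norm (z i) * B)\<^sup>2"
        unfolding ft norm_mult by (intro power_mono mult_left_mono) auto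
      then show "\<exists>i\<in>{..j}. t \<in> {y i - L * w..y i + L * w} \<and> (norm (f z t))\<^sup>2 \<le> (norm (z i) * B)\<^sup>2"
        using i e_nz[OF i(2)] unfolding mem_interval_abs by (intro bexI[of _ i]) auto
    qed auto
    then show ?thesis
      by (simp add: S_def power_mult_distrib sum_distrib_left mult_ac)
  qed
  show ?thesis
  proof (rule sing_val_ge[OF T, of j e, OF e_L2], unfold f_def[symmetric, abs_def])
    fix z
    define q where "q = \<kappa> * a * w / (B * sqrt (2 * L))"
    have q: "q \<ge> 0" using \<kappa> a w B_ge L by (auto simp: q_def)
    have qq: "q\<^sup>2 * (B\<^sup>2 * (2 * L * w)) = (\<kappa> * a * w)\<^sup>2 * w"
      using B_ge L by (simp add: q_def power_divide power_mult_distrib)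
    have "(q * L2_norm (f z))\<^sup>2 \<le> q\<^sup>2 * (B\<^sup>2 * (2 * L * w) * S z)"
      unfolding power_mult_distrib by (intro mult_left_mono upperf) auto
    also have "\<dots> = (\<kappa> * a * w)\<^sup>2 * w * S z" using qq by (simp add: mult.assoc[symmetric])
    also have "\<dots> \<le> (L2_norm (T (f z)))\<^sup>2" by (rule lowerT)
    finally show "\<kappa> * a * w / (B * sqrt (2 * L)) * L2_norm (f z) \<le> L2_norm (T (f z))"
      unfolding q_def[symmetric] by (rule power2_le_imp_le) simp
  next
    fix z :: "nat \<Rightarrow> complex" assume "\<exists>i\<le>j. z i \<noteq> 0"
    then have "0 < S z" unfolding S_def by (auto intro!: sum_pos2)
    then have "0 < (\<kappa> * a * w)\<^sup>2 * w * S z" using \<kappa> a w by simp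
    then have "0 < (L2_norm (T (f z)))\<^sup>2" using lowerT[of z] by linarith
    then show "0 < L2_norm (T (f z))" using L2_norm_nonneg[of "T (f z)"] by (simp add: less_le)
  qed auto
qed

end

section \<open>Unbounded Hankel operators\<close>

lemma square_powr_minus_half:
  fixes d K :: real
  assumes "d > 0"
  shows "(K * d powr (- 1/2))\<^sup>2 = K\<^sup>2 / d"
  using assms powr_neg_one[of d] by (simp add: power_mult_distrib powr_power)

text \<open>
  The points \<open>r / 4\<^sup>n\<close> are so sparse that the intervals from half to three halves of each are disjoint.
\<close>

lemma quarter_scales:
  fixes r :: real
  assumes "0 < r"
  shows "0 < r / 4 ^ n" "r / 4 ^ n \<le> r" "m < n \<Longrightarrow> r / 4 ^ n \<le> r / 4 ^ m / 4"
proof -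
  show "0 < r / 4 ^ n" using assms by simp
  have "1 \<le> (4::real) ^ n" by simp
  then show "r / 4 ^ n \<le> r" using assms by (simp add: divide_le_eq)
  assume "m < n"
  then have "(4::real) ^ Suc m \<le> 4 ^ n" by (intro power_increasing) auto
  then show "r / 4 ^ n \<le> r / 4 ^ m / 4" using assms by (simp add: divide_simps)
qed

context bump
begin

text \<open>
  The symbol for \<open>p \<le> 2\<close>: a bump around \<open>1\<close> with support in \<open>[1/2, 3/2]\<close>.
\<close>

definition wide_bump :: "real \<Rightarrow> complex" where
  "wide_bump t = of_real (bump_at 1 (1 / (2 * L)) t)"

lemma wide_bump_zero: "x \<notin> {1/2..3/2} \<Longrightarrow> wide_bump x = 0"
  unfolding wide_bump_def using L
  by (subst bump_at_zero) (auto simp: abs_if)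

lemma smooth_wide_bump: "smooth wide_bump"
  unfolding wide_bump_def[abs_def] by (rule smooth_bump_at)

text \<open>
  For a bump \<open>f\<close> around \<open>1\<close> and small \<open>s\<close> the integral defining the operator is bounded below, so that its
  value at \<open>s\<close> is at least \<open>K s\<^sup>\<alpha>\<close>. The square is not integrable at \<open>0\<close>: every interval \<open>[d/2, d]\<close> with
  \<open>d = w / 4\<^sup>n\<close> contributes at least \<open>K\<^sup>2/2\<close>.
\<close>

lemma wide_bump_unbounded_left:
  assumes T: "bounded_op T"
    and agree: "\<And>f. f \<in> test_functions \<Longrightarrow> AE s in Rplus. T f s = hankel \<alpha> \<beta> (regular_dist wide_bump) f s"
    and \<alpha>: "\<alpha> \<le> - 1/2"
  shows False
proof -
  define w where "w = 1 / (4 * L)"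
  have w: "0 < w" "w \<le> 1/4" "L * w = 1/4" using L by (auto simp: w_def field_simps)
  define f where "f t = complex_of_real (bump_at 1 w t)" for t
  have f: "f \<in> test_functions" "f \<in> L2"
    unfolding f_def[abs_def] using w by (auto intro!: bump_at_test bump_at_L2)
  define K where "K = 2 powr (- \<bar>\<beta>\<bar>) * w"
  have K: "K > 0" using w by (simp add: K_def)
  have point: "K * s powr \<alpha> \<le> norm (hankel \<alpha> \<beta> (regular_dist wide_bump) f s)"
    if s: "0 < s" "s \<le> w" for s
  proof -
    define G where "G t = bump_at 1 (1 / (2 * L)) (s + t) * bump_at 1 w t" for t
    have "norm (1::complex) * (\<Sum>u\<in>{()}. s powr \<alpha> * 2 powr (- \<bar>\<beta>\<bar>) * ((1 + w/2) - (1 - w/2)))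
        \<le> norm (hankel \<alpha> \<beta> (regular_dist wide_bump) f s)"
    proof (rule hankel_lower[OF f(1) s(1), where G = G and a = "3/4" and b = "5/4"])
      show "wide_bump (s + t) * f t = 1 * of_real (G t)" for t
        by (simp add: wide_bump_def f_def G_def)
      show "continuous_on {3/4..5/4} G"
        unfolding G_def
        by (intro continuous_intros continuous_bump_at continuous_on_compose2[OF continuous_bump_at[of UNIV]]) auto
      show "G t = 0" if "t \<notin> {3/4..5/4}" for t
        using that bump_at_outside[OF w(1), of t 1] w(3) by (simp add: G_def)
      show "(\<Sum>u\<in>{()}. s powr \<alpha> * 2 powr (- \<bar>\<beta>\<bar>) * indicator {1 - w/2..1 + w/2} t)
          \<le> s powr \<alpha> * t powr \<beta> * G t" for t
      proof (cases "t \<in> {1 - w/2..1 + w/2}")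
        case True
        have w2: "1 / (2 * L) = 2 * w" by (simp add: w_def)
        have "1 * 1 \<le> G t"
          unfolding G_def w2 using True s w by (intro mult_mono bump_at_ge) (auto simp: abs_le_iff)
        moreover have "2 powr (- \<bar>\<beta>\<bar>) \<le> t powr \<beta>"
          using powr_ge_scale[of 1 t \<beta>] True w by auto
        ultimately have "s powr \<alpha> * 2 powr (- \<bar>\<beta>\<bar>) * (1 * 1) \<le> s powr \<alpha> * t powr \<beta> * G t"
          by (intro mult_mono mult_left_mono) auto
        then show ?thesis using True by simp
      qed (simp add: G_def bump_at_nonneg)
    qed (use w in auto)
    then show ?thesis using w by (simp add: K_def mult_ac)
  qed
  define d where "d n = w / 4 ^ n" for n :: nat
  note d = quarter_scales(1,2)[OF w(1), folded d_def] and dd = quarter_scales(3)[OF w(1), folded d_def]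
  have "real N * (K\<^sup>2 / 2) \<le> (L2_norm (T f))\<^sup>2" for N
  proof -
    have "(\<Sum>n\<in>{..<N}. K\<^sup>2 / d n * (d n - d n / 2)) \<le> (L2_norm (T f))\<^sup>2"
    proof (rule L2_norm_ge_step)
      show "disjoint_family_on (\<lambda>n. {d n / 2..d n}) {..<N}"
        unfolding disjoint_family_on_def
      proof safe
        fix m n t assume "m \<noteq> n" and t: "t \<in> {d m / 2..d m}" "t \<in> {d n / 2..d n}"
        then show "t \<in> {}" using dd[of m n] dd[of n m] d(1)[of m] d(1)[of n]
          by (cases "m < n") auto
      qed
      show "T f \<in> L2" by (rule bounded_opD(1)[OF T f(2)])
      show "AE s in Rplus. \<forall>n\<in>{..<N}. s \<in> {d n / 2..d n} \<longrightarrow> K\<^sup>2 / d n \<le> (norm (T f s))\<^sup>2"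
        using agree[OF f(1)]
      proof eventually_elim
        case (elim s)
        show ?case
        proof safe
          fix n assume s: "s \<in> {d n / 2..d n}"
          then have s': "0 < s" "s \<le> w" "s \<le> 1" using d[of n] w by auto
          have "d n powr (- 1/2) \<le> s powr (- 1/2)" using s s' by (intro powr_mono2') auto
          also have "\<dots> \<le> s powr \<alpha>" using s' \<alpha> by (intro powr_mono') auto
          finally have "K * d n powr (- 1/2) \<le> K * s powr \<alpha>" using K by simp
          also have "\<dots> \<le> norm (T f s)" using point[OF s'(1,2)] elim by simp
          finally have "K * d n powr (- 1/2) \<le> norm (T f s)" .
          then have "(K * d n powr (- 1/2))\<^sup>2 \<le> (norm (T f s))\<^sup>2"
            using K by (intro power_mono) auto
          also have "(K * d n powr (- 1/2))\<^sup>2 = K\<^sup>2 / d n"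
            by (rule square_powr_minus_half[OF d(1)])
          finally show "K\<^sup>2 / d n \<le> (norm (T f s))\<^sup>2" .
        qed
      qed
    qed (use d in \<open>auto simp: less_imp_le\<close>)
    moreover have "K\<^sup>2 / d n * (d n - d n / 2) = K\<^sup>2 / 2" for n using d(1)[of n] by (simp add: field_simps)
    ultimately show ?thesis by simp
  qed
  moreover obtain N where "(L2_norm (T f))\<^sup>2 < real N * (K\<^sup>2 / 2)"
    using reals_Archimedean3[of "K\<^sup>2 / 2"] K by auto
  ultimately show False by (meson not_le)
qed

text \<open>
  For \<open>s\<close> slightly larger than \<open>1\<close> the symbol is at least \<open>1\<close> at \<open>s + y\<close> for all small \<open>y\<close>, so the operator
  contains the functional \<open>f \<mapsto> \<integral> y\<^sup>\<beta> f(y) dy\<close>. It is at least of order \<open>1\<close> on every \<open>g n\<close>, a bump at scale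
  \<open>4\<^sup>-\<^sup>n\<close> with norm of order \<open>1\<close>. The \<open>g n\<close> are disjointly supported, so their sum over \<open>n < N\<close> has
  norm \<open>O(sqrt N)\<close> while the functional grows like \<open>N\<close>.
\<close>

lemma wide_bump_unbounded_right:
  assumes T: "bounded_op T"
    and agree: "\<And>f. f \<in> test_functions \<Longrightarrow> AE s in Rplus. T f s = hankel \<alpha> \<beta> (regular_dist wide_bump) f s"
    and \<beta>: "\<beta> \<le> - 1/2"
  shows False
proof -
  \<comment> \<open>All supports lie in \<open>(0, 3 r / 2]\<close>, and \<open>3 r / 2 = 1 / (4 L)\<close> is half the radius on which the symbol is at least \<open>1\<close>.\<close>
  define r where "r = 1 / (6 * L)"
  have r: "0 < r" "r \<le> 1/6" using L by (auto simp: r_def field_simps)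
  define d where "d n = r / 4 ^ n" for n :: nat
  note d = quarter_scales(1,2)[OF r(1), folded d_def] and dd = quarter_scales(3)[OF r(1), folded d_def]
  define w where "w n = d n / (2 * L)" for n
  have w: "0 < w n" "L * w n = d n / 2" "w n \<le> d n / 2" for n
    using L d(1)[of n] by (auto simp: w_def field_simps intro: mult_right_mono[of 1, simplified])
  define g where "g n t = d n powr (- 1/2) * bump_at (d n) (w n) t" for n t
  have g_nonneg: "0 \<le> g n t" for n t by (simp add: g_def bump_at_nonneg)
  have g_zero: "g n t = 0" if "t \<notin> {d n / 2..3 * d n / 2}" for n t
    using that bump_at_outside[OF w(1), of t "d n" n] w(2)[of n] d(1)[of n] by (simp add: g_def)
  define f where "f N t = complex_of_real (\<Sum>n<N. g n t)" for N t
  have f_eq: "f N t = (\<Sum>n<N. of_real (d n powr (- 1/2)) * of_real (bump_at (d n) (w n) t))" for N t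
    by (simp add: f_def g_def)
  have f_test: "f N \<in> test_functions" for N
    unfolding f_eq[abs_def]
  proof (intro test_functions_sum test_functions_scale bump_at_test)
    show "L * w n < d n" for n using w(2)[of n] d(1)[of n] by linarith
  qed (use w in auto)
  have normf: "f N \<in> L2 \<and> (L2_norm (f N))\<^sup>2 \<le> real N * B\<^sup>2" for N
  proof -
    have h: "\<exists>n\<in>{..<N}. t \<in> {d n / 2..3 * d n / 2} \<and> (norm (f N t))\<^sup>2 \<le> B\<^sup>2 / d n"
      if nz: "f N t \<noteq> 0" for t
    proof -
      have "(\<Sum>n<N. g n t) \<noteq> 0" using nz by (simp add: f_def del: of_real_sum)
      then obtain n where "n \<in> {..<N}" and gn: "g n t \<noteq> 0"
        by (rule sum.not_neutral_contains_not_neutral)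
      then have n: "n < N" by simp
      have t: "t \<in> {d n / 2..3 * d n / 2}" using gn g_zero by blast
      have "g m t = 0" if "m \<noteq> n" for m
        by (rule g_zero) (use that t dd[of m n] dd[of n m] d(1)[of m] d(1)[of n] in \<open>cases "m < n"; auto\<close>)
      then have "(\<Sum>n<N. g n t) = (\<Sum>m<N. if m = n then g n t else 0)" by (intro sum.cong) auto
      then have "(norm (f N t))\<^sup>2 = (g n t)\<^sup>2" using n by (simp add: f_def)
      also have "\<dots> \<le> (d n powr (- 1/2) * B)\<^sup>2"
        unfolding g_def by (intro power_mono mult_left_mono bump_at_le) (auto simp: bump_at_nonneg)
      also have "\<dots> = B\<^sup>2 / d n"
        using square_powr_minus_half[OF d(1)[of n], of B] by (simp add: mult.commute)
      finally show ?thesis using n t by auto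
    qed
    have m: "f N \<in> borel_measurable borel"
      using f_test[of N] by (auto simp: test_functions_def intro: smooth_borel_measurable)
    have "B\<^sup>2 / d n * (3 * d n / 2 - d n / 2) = B\<^sup>2" for n using d(1)[of n] by (simp add: field_simps)
    moreover have *: "0 < d n / 2 \<and> d n / 2 \<le> 3 * d n / 2" "0 \<le> B\<^sup>2 / d n" for n
      using d(1)[of n] by auto
    ultimately show ?thesis
      using L2_norm_le_step[of "{..<N}" "\<lambda>n. d n / 2" "\<lambda>n. 3 * d n / 2" "\<lambda>n. B\<^sup>2 / d n" "f N"] m h
      by simp
  qed
  define K where "K = 2 powr (- \<bar>\<alpha>\<bar>) / (2 * L)"
  have K: "K > 0" using L by (simp add: K_def)
  define l where "l = 1 / (4 * L)"
  have l: "l > 0" "l \<le> 1/4" using L by (auto simp: l_def field_simps)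
  have point: "K * N \<le> norm (hankel \<alpha> \<beta> (regular_dist wide_bump) (f N) s)"
    if s: "1 \<le> s" "s \<le> 1 + l" for s and N :: nat
  proof -
    define G where "G t = bump_at 1 (1 / (2 * L)) (s + t) * (\<Sum>n<N. g n t)" for t
    have "norm (1::complex) * (\<Sum>n<N. 2 powr (- \<bar>\<alpha>\<bar>) / (2 * d n) * ((d n + w n) - (d n - w n)))
        \<le> norm (hankel \<alpha> \<beta> (regular_dist wide_bump) (f N) s)"
    proof (rule hankel_lower[OF f_test, where G = G and a = "d N / 2" and b = "1"])
      show "s > 0" using s by simp
      show "wide_bump (s + t) * f N t = 1 * of_real (G t)" for t
        by (simp add: wide_bump_def f_def G_def)
      show "continuous_on {d N / 2..1} G"
        unfolding G_def g_def
        by (intro continuous_intros continuous_bump_at continuous_on_compose2[OF continuous_bump_at[of UNIV]]) auto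
      show "G t = 0" if t: "t \<notin> {d N / 2..1}" for t
      proof -
        have "g n t = 0" if "n < N" for n
          by (rule g_zero) (use t dd[OF that] d[of n] d(1)[of N] r in auto)
        then show ?thesis by (simp add: G_def)
      qed
      show "(\<Sum>n<N. 2 powr (- \<bar>\<alpha>\<bar>) / (2 * d n) * indicator {d n - w n..d n + w n} t)
          \<le> s powr \<alpha> * t powr \<beta> * G t" if t: "t > 0" for t
      proof -
        have sa: "2 powr (- \<bar>\<alpha>\<bar>) \<le> s powr \<alpha>"
          using powr_ge_scale[of 1 s \<alpha>] s l by auto
        have "2 powr (- \<bar>\<alpha>\<bar>) / (2 * d n) * indicator {d n - w n..d n + w n} t
           \<le> s powr \<alpha> * t powr \<beta> * (bump_at 1 (1 / (2 * L)) (s + t) * g n t)" for n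
        proof (cases "t \<in> {d n - w n..d n + w n}")
          case True
          have t2: "t \<le> 3 * d n / 2" using True w(3)[of n] by auto
          then have t3: "t \<le> 4 * d n" "t \<le> 1" using d[of n] r by auto
          have "3 * d n / 2 \<le> l" using d(2)[of n] by (simp add: l_def r_def)
          then have "\<bar>s + t - 1\<bar> \<le> 1 / (2 * L)"
            using s t t2 by (simp add: l_def)
          then have 1: "1 \<le> bump_at 1 (1 / (2 * L)) (s + t)" using L by (intro bump_at_ge) auto
          have "1 \<le> bump_at (d n) (w n) t" using True w(1)[of n] by (intro bump_at_ge) (auto simp: abs_le_iff)
          then have 2: "d n powr (- 1/2) * 1 \<le> g n t" unfolding g_def by (intro mult_left_mono) auto
          have "d n powr (- 1/2) / 2 = (4 * d n) powr (- 1/2)"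
            using d(1)[of n] by (simp add: powr_mult powr_minus powr_half_sqrt)
          also have "\<dots> \<le> t powr (- 1/2)" using t t3 by (intro powr_mono2') auto
          also have "\<dots> \<le> t powr \<beta>" using t t3 \<beta> by (intro powr_mono') auto
          finally have 3: "d n powr (- 1/2) / 2 \<le> t powr \<beta>" .
          have "2 powr (- \<bar>\<alpha>\<bar>) * (d n powr (- 1/2) / 2) * (1 * (d n powr (- 1/2) * 1))
            \<le> s powr \<alpha> * t powr \<beta> * (bump_at 1 (1 / (2 * L)) (s + t) * g n t)"
            by (intro mult_mono sa 1 2 3) (auto simp: bump_at_nonneg)
          moreover have "d n powr (- 1/2) * d n powr (- 1/2) = 1 / d n"
            using square_powr_minus_half[OF d(1)[of n], of 1] by (simp add: power2_eq_square)
          then have "2 powr (- \<bar>\<alpha>\<bar>) * (d n powr (- 1/2) / 2) * (1 * (d n powr (- 1/2) * 1))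
              = 2 powr (- \<bar>\<alpha>\<bar>) / (2 * d n)"
            by (simp add: field_simps)
          ultimately show ?thesis using True by simp
        qed (simp add: g_nonneg bump_at_nonneg)
        then show ?thesis unfolding G_def sum_distrib_left by (intro sum_mono) auto
      qed
      show "0 < d n - w n \<and> d n - w n \<le> d n + w n" for n using d(1)[of n] w(1,3)[of n] by auto
    qed (use d in auto)
    moreover have "2 powr (- \<bar>\<alpha>\<bar>) / (2 * d n) * ((d n + w n) - (d n - w n)) = K" for n
      using d(1)[of n] L by (simp add: w_def K_def field_simps)
    ultimately show ?thesis by (simp add: mult_ac)
  qed
  have lower: "(K * N)\<^sup>2 * l \<le> (L2_norm (T (f N)))\<^sup>2" for N :: nat
  proof -
    have "(\<Sum>n\<in>{()}. (K * N)\<^sup>2 * ((1 + l) - 1)) \<le> (L2_norm (T (f N)))\<^sup>2"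
    proof (rule L2_norm_ge_step)
      show "T (f N) \<in> L2" using normf by (intro bounded_opD(1)[OF T]) auto
      show "AE s in Rplus. \<forall>n\<in>{()}. s \<in> {1..1 + l} \<longrightarrow> (K * N)\<^sup>2 \<le> (norm (T (f N) s))\<^sup>2"
        using agree[OF f_test[of N]] by eventually_elim (use point[of _ N] K in \<open>auto intro!: power_mono\<close>)
    qed (use l in \<open>auto simp: disjoint_family_on_def\<close>)
    then show ?thesis by simp
  qed
  obtain C where C: "C \<ge> 0" "\<And>f. f \<in> L2 \<Longrightarrow> L2_norm (T f) \<le> C * L2_norm f"
    using bounded_opE[OF T] by blast
  have *: "real N * (K\<^sup>2 * l) \<le> C\<^sup>2 * B\<^sup>2" if "N > 0" for N :: nat
  proof -
    have "(L2_norm (T (f N)))\<^sup>2 \<le> (C * L2_norm (f N))\<^sup>2"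
      using normf C by (intro power_mono) auto
    also have "\<dots> \<le> C\<^sup>2 * (real N * B\<^sup>2)"
      unfolding power_mult_distrib using normf by (intro mult_left_mono) auto
    finally have "real N * (real N * (K\<^sup>2 * l)) \<le> real N * (C\<^sup>2 * B\<^sup>2)"
      using lower[of N] by (simp add: power2_eq_square mult_ac)
    then show ?thesis using that by simp
  qed
  obtain N where N: "C\<^sup>2 * B\<^sup>2 < real N * (K\<^sup>2 * l)"
    using reals_Archimedean3[of "K\<^sup>2 * l"] K l by auto
  have "0 \<le> C\<^sup>2 * B\<^sup>2" by simp
  with N have "0 < real N * (K\<^sup>2 * l)" by linarith
  then have "N > 0" by (cases "N = 0") auto
  with *[of N] N show False by linarith
qed

end

section \<open>Lacunary sums of narrow bumps\<close>

text \<open>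
  For small \<open>p\<close> the Fourier transform has to decay faster than \<open>\<bar>\<xi>\<bar>\<^sup>-\<^sup>1\<^sup>/\<^sup>p\<close>, which takes about \<open>2/p\<close>
  integrations by parts.
\<close>

lemma smooth_fourier_in_Lp:
  assumes "smooth g" "\<And>x. x \<notin> {a..b} \<Longrightarrow> g x = 0" "p > 0"
  shows "in_Lp p (fourier g)"
proof -
  \<comment> \<open>Enough derivatives for \<open>m p \<ge> 2\<close>, as required for the comparison with a Cauchy density.\<close>
  define m where "m = nat \<lceil>2 / p\<rceil>"
  have "2 / p \<le> m" unfolding m_def by linarith
  then have mp: "real m * p \<ge> 2" using assms(3) by (simp add: field_simps)
  note * = fourier_higher_deriv[where m = m and a = a and b = b, OF assms(1,2)]
  obtain M where M: "M \<ge> 0" "\<And>x. norm (g x) \<le> M"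
    using smooth_compact_bounded[OF assms(1,2)] by blast
  have "smooth ((vderiv ^^ m) g)" "\<And>x. x \<notin> {a..b} \<Longrightarrow> (vderiv ^^ m) g x = 0" using * by auto
  then obtain M' where M': "M' \<ge> 0" "\<And>x. norm ((vderiv ^^ m) g x) \<le> M'"
    using smooth_compact_bounded by blast
  define b' where "b' = max a b"
  have z: "\<And>x. x \<notin> {a..b'} \<Longrightarrow> g x = 0" "\<And>x. x \<notin> {a..b'} \<Longrightarrow> (vderiv ^^ m) g x = 0" "a \<le> b'"
    using assms(2) * by (auto simp: b'_def le_max_iff_disj)
  define D where "D = max M M' * (b' - a)"
  have D: "M * (b' - a) \<le> D" "M' * (b' - a) \<le> D"
    using z(3) by (auto simp: D_def intro: mult_right_mono)
  show ?thesis
  proof (rule decay_Lp(1)[where D = D and w = 1 and m = m])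
    show "fourier g \<in> borel_measurable borel"
      by (intro fourier_measurable smooth_borel_measurable assms)
    show "norm (fourier g \<xi>) \<le> D" for \<xi>
      by (rule order.trans[OF fourier_le D(1)]) (use z M assms smooth_continuous in auto)
    show "\<bar>1 * \<xi>\<bar> ^ m * norm (fourier g \<xi>) \<le> D" for \<xi>
    proof -
      have "\<bar>1 * \<xi>\<bar> ^ m * norm (fourier g \<xi>) = norm (fourier ((vderiv ^^ m) g) \<xi>)"
        using * by (simp add: norm_mult norm_power)
      also have "\<dots> \<le> D"
        by (rule order.trans[OF fourier_le D(2)]) (use z M' * smooth_continuous in auto)
      finally show ?thesis .
    qed
  qed (use mp assms in auto)
qed

context bump
begin

lemma wide_bump_locally_integrable: "locally_integrable wide_bump"
  unfolding locally_integrable_def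
proof safe
  fix K :: "real set" assume "compact K"
  then show "set_integrable lborel K wide_bump"
    unfolding set_integrable_def
    by (intro borel_integrable_compact smooth_continuous smooth_wide_bump)
qed

text \<open>
  Only finitely many dyadic blocks meet the support, and each of them is the Fourier transform of a smooth
  compactly supported function.
\<close>

lemma wide_bump_besov:
  assumes v: "dyadic_cutoff v" and p: "p > 0"
  shows "regular_dist wide_bump \<in> besov_class v p s"
proof -
  note v' = dyadic_cutoff_props[OF v]
  define G where "G j x = v (x / 2 powi j) * wide_bump x" for j x
  have block: "besov_block v j (regular_dist wide_bump) = fourier (G j)" for j
    unfolding G_def by (rule besov_block_regular) (use v' in auto)
  have "smooth (G j)" for j
    unfolding G_def using smooth_affine[OF v'(1), of "1 / 2 powi j" 0]
    by (intro smooth_mult smooth_wide_bump) simp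
  then have Lp: "in_Lp p (fourier (G j))" for j
    by (rule smooth_fourier_in_Lp[of _ "1/2" "3/2"]) (auto simp: G_def wide_bump_zero p)
  have "G j x = 0" if j: "j \<notin> {-3..3}" for j x
  proof (cases "x \<in> {1/2..3/2}")
    case True
    have "x / 2 powi j \<notin> {1/2..2}"
    proof (cases "j > 3")
      case True
      then have "(2::real) powi 4 \<le> 2 powi j" by (intro power_int_increasing) auto
      then have "x < 1/2 * 2 powi j" using \<open>x \<in> {1/2..3/2}\<close> by simp
      then show ?thesis by (simp add: field_simps)
    next
      case False
      then have "2 powi j \<le> (2::real) powi -4" using j by (intro power_int_increasing) auto
      also have "\<dots> = 1 / 16" by (simp add: power_int_def power_divide)
      finally have "2 * 2 powi j < x" using \<open>x \<in> {1/2..3/2}\<close> by simp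
      then show ?thesis by (simp add: field_simps)
    qed
    then show ?thesis by (simp add: G_def v')
  qed (simp add: G_def wide_bump_zero)
  then have "fourier (G j) = (\<lambda>_. 0)" if "j \<notin> {-3..3}" for j
    using that by (simp add: fourier_def fun_eq_iff)
  then have z: "(2 powr (of_int j * s) * Lp_norm p (fourier (G j))) powr p = 0" if "j \<notin> {-3..3}" for j
    using that p by (simp add: Lp_norm_def)
  have "(\<lambda>j::int. (2 powr (of_int j * s) * Lp_norm p (fourier (G j))) powr p) summable_on UNIV \<longleftrightarrow>
    (\<lambda>j::int. (2 powr (of_int j * s) * Lp_norm p (fourier (G j))) powr p) summable_on {-3..3}"
    by (rule summable_on_cong_neutral) (use z in auto)
  then have "(\<lambda>j::int. (2 powr (of_int j * s) * Lp_norm p (fourier (G j))) powr p) summable_on UNIV"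
    by simp
  then show ?thesis
    using Lp distribution_regular_dist[OF wide_bump_locally_integrable]
    by (simp add: besov_class_def block)
qed

end

text \<open>
  The number \<open>M l\<close> determines how narrow the bump in block \<open>l\<close> is, and \<open>harm (M l)\<close> is the factor by which
  the Schatten sum exceeds the Besov norm there. The latter is of order \<open>4\<^sup>-\<^sup>l\<close> (as a \<open>p\<close>-th power), so the growth
  \<open>16\<^sup>l\<close> makes the product unbounded.
\<close>

locale lacunary_bumps = bump +
  fixes M :: "nat \<Rightarrow> nat" and \<alpha> \<beta> p :: real
  assumes p: "p > 2" and M: "\<And>l. M l \<ge> 1" and harm_M: "\<And>l. harm (M l) \<ge> (16 :: real) ^ l"
begin

text \<open>
  The bump \<open>g l\<close> has its centre at \<open>3/2 u l\<close>, in the interior of the range \<open>[u l, 2 u l]\<close>. Its width leaves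
  room for \<open>M l\<close> test functions at distances \<open>5 L (w l) i\<close> from the boundary, \<open>i \<le> M l\<close>, the last at
  distance \<open>u l / 8\<close>.
\<close>

definition u :: "nat \<Rightarrow> real" where "u l = 4 ^ l"

definition w :: "nat \<Rightarrow> real" where "w l = u l / (40 * L * M l)"

text \<open>
  Chosen so that \<open>(u l)\<^sup>1\<^sup>+\<^sup>p\<^sup>\<alpha>\<^sup>+\<^sup>p\<^sup>\<beta> (a l)\<^sup>p (w l)\<^sup>p\<^sup>-\<^sup>1 = 1 / u l\<close>. The left-hand side is the order of the \<open>p\<close>-th power
  of the Besov norm of \<open>g l\<close>, with the factor \<open>2\<^sup>j\<^sup>s\<^sup>p\<close> for the smoothness \<open>s = 1/p + \<alpha> + \<beta>\<close> at \<open>2\<^sup>j\<close> comparable to \<open>u l\<close>.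
\<close>

definition a :: "nat \<Rightarrow> real" where
  "a l = (u l powr (- (2 + p * \<alpha> + p * \<beta>)) * w l powr (1 - p)) powr (1 / p)"

definition g :: "nat \<Rightarrow> real \<Rightarrow> real" where
  "g l t = a l * bump_at (3/2 * u l) (w l) t"

text \<open>
  The sum of all \<open>g l\<close>. The range of summation depends on \<open>t\<close> to make it finite; the terms left out vanish
  at \<open>t\<close>, as \<open>4\<^sup>l > l \<ge> t\<close> (see \<open>\<psi>_eq\<close>).
\<close>

definition \<psi> :: "real \<Rightarrow> complex" where
  "\<psi> t = of_real (\<Sum>l<nat \<lceil>t\<rceil>. g l t)"

lemma u_pos: "0 < u l" and u_ge: "1 \<le> u l"
  by (simp_all add: u_def)

lemma M_pos: "0 < real (M l)"
  using M[of l] by simp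

lemma w_pos: "0 < w l"
  using u_pos M_pos L by (simp add: w_def)

lemma w_u: "40 * (L * w l * M l) = u l"
  using L M_pos[of l] by (simp add: w_def)

lemma Lw_le: "L * w l \<le> u l / 40" "w l \<le> L * w l" "0 < L * w l"
proof -
  show 0: "0 < L * w l" using L w_pos by simp
  show "w l \<le> L * w l" using L w_pos[of l] by simp
  have "L * w l * 1 \<le> L * w l * M l" using 0 M[of l] by (intro mult_left_mono) auto
  then show "L * w l \<le> u l / 40" using w_u[of l] by linarith
qed

lemma a_pos: "0 < a l"
  using u_pos[of l] w_pos[of l] by (simp add: a_def)

lemma a_powr: "a l powr p = u l powr (- (2 + p * \<alpha> + p * \<beta>)) * w l powr (1 - p)"
  using p u_pos[of l] w_pos[of l] by (simp add: a_def powr_powr)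

lemma g_zero: "t \<notin> {5/4 * u l..7/4 * u l} \<Longrightarrow> g l t = 0"
  unfolding g_def using bump_at_outside[OF w_pos, of t "3/2 * u l" l] Lw_le[of l] u_pos[of l]
  by auto

lemma g_nonneg: "0 \<le> g l t"
  using a_pos[of l] by (simp add: g_def)

lemma \<psi>_eq: 
  assumes "t \<le> real N"
  shows "\<psi> t = of_real (\<Sum>l<N. g l t)"
proof -
  have "(\<Sum>l<nat \<lceil>t\<rceil>. g l t) = (\<Sum>l<N. g l t)"
  proof (rule sum.mono_neutral_left)
    show "\<forall>l\<in>{..<N} - {..<nat \<lceil>t\<rceil>}. g l t = 0"
    proof
      fix l assume "l \<in> {..<N} - {..<nat \<lceil>t\<rceil>}"
      then have "t \<le> real l" by (auto simp: not_less)
      also have "real l < 2 ^ l" by (rule of_nat_less_two_power)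
      also have "(2::real) ^ l \<le> 4 ^ l" by (intro power_mono) auto
      finally show "g l t = 0" by (intro g_zero) (auto simp: u_def)
    qed
  qed (use assms in \<open>auto simp: ceiling_le_iff nat_le_iff\<close>)
  then show ?thesis by (simp add: \<psi>_def)
qed

lemma u_mono: "k < l \<Longrightarrow> 4 * u k \<le> u l"
  using power_increasing[of "Suc k" l "4::real"] by (simp add: u_def)

text \<open>
  The factor \<open>4\<close> between consecutive bumps is used here: the range \<open>[u l / 2, 4 u l]\<close> contains the two
  dyadic blocks \<open>2\<^sup>2\<^sup>l [1/2, 2]\<close> and \<open>2\<^sup>2\<^sup>l\<^sup>+\<^sup>1 [1/2, 2]\<close> and meets no bump but \<open>g l\<close>. Hence block \<open>j\<close> sees exactly
  one bump, with index \<open>j div 2\<close>.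
\<close>

lemma \<psi>_block:
  assumes "u l / 2 \<le> t" "t \<le> 4 * u l"
  shows "\<psi> t = of_real (g l t)"
proof -
  define N where "N = max (nat \<lceil>t\<rceil>) (Suc l)"
  have N: "t \<le> real N" "l < N" unfolding N_def by linarith+
  have "g k t = 0" if "k \<noteq> l" for k
    by (rule g_zero) (use that assms u_mono[of k l] u_mono[of l k] u_pos[of l] u_pos[of k] in \<open>cases "k < l"; auto\<close>)
  then have "(\<Sum>k<N. g k t) = (\<Sum>k<N. if k = l then g l t else 0)" by (intro sum.cong) auto
  then show ?thesis using N by (simp add: \<psi>_eq[OF N(1)])
qed

lemma \<psi>_small: "t \<le> 1 \<Longrightarrow> \<psi> t = 0"
  using \<psi>_eq[of t 1] g_zero[of t 0] by (simp add: u_def)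

lemma continuous_g: "continuous_on A (g l)"
  unfolding g_def[abs_def] by (intro continuous_intros continuous_bump_at)

lemma \<psi>_locally_integrable: "locally_integrable \<psi>"
  unfolding locally_integrable_def
proof safe
  fix K :: "real set" assume K: "compact K"
  then obtain b where b: "\<And>t. t \<in> K \<Longrightarrow> \<bar>t\<bar> \<le> b"
    using compact_imp_bounded[OF K] unfolding bounded_iff by auto
  define N where "N = nat \<lceil>b\<rceil>"
  have "t \<le> real N" if "t \<in> K" for t using b[OF that] unfolding N_def by linarith
  then have eq: "indicator K t *\<^sub>R \<psi> t = indicator K t *\<^sub>R complex_of_real (\<Sum>l<N. g l t)" for t
    using \<psi>_eq[of t N] by (auto simp: indicator_def simp del: of_real_sum)
  show "set_integrable lborel K \<psi>"
    unfolding set_integrable_def eq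
    by (intro borel_integrable_compact K continuous_intros continuous_g)
qed

lemma dyadic_scale:
  assumes "j \<ge> 0"
  shows "u (nat j div 2) \<le> 2 powi j" "2 powi j \<le> 2 * u (nat j div 2)"
proof -
  define m where "m = nat j div 2"
  have um: "u m = 2 ^ (2 * m)" by (simp add: u_def power_mult)
  have "n = 2 * (n div 2) \<or> n = Suc (2 * (n div 2))" for n :: nat by presburger
  from this[of "nat j"] have "nat j = 2 * m \<or> nat j = Suc (2 * m)" by (simp only: m_def)
  then have "(2::real) ^ nat j = u m \<or> (2::real) ^ nat j = 2 * u m"
    unfolding um by (elim disjE) simp_all
  then show "u (nat j div 2) \<le> 2 powi j" "2 powi j \<le> 2 * u (nat j div 2)"
    using assms u_pos[of m] by (auto simp: power_int_def m_def[symmetric])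
qed

text \<open>
  Uniformly in \<open>l\<close>: the cutoff varies on the scale \<open>2\<^sup>j \<ge> w l\<close>, so it does not spoil the derivative of the bump,
  which is of order \<open>a l / w l\<close> on a set of measure \<open>2 L (w l)\<close>. One integration by parts suffices as \<open>p > 2\<close>.
\<close>

lemma besov_block_bound:
  assumes v: "dyadic_cutoff v"
  obtains D where "D > 0"
    "\<And>j l. j \<ge> 0 \<Longrightarrow> l = nat j div 2 \<Longrightarrow> in_Lp p (besov_block v j (regular_dist \<psi>)) \<and>
      (LBINT \<xi>. norm (besov_block v j (regular_dist \<psi>) \<xi>) powr p) \<le> (a l * w l * D) powr p * cauchy_mass / w l"
proof -
  note v' = dyadic_cutoff_props[OF v]
  obtain V where V: "V \<ge> 0" "\<And>x. norm (v x) \<le> V" using smooth_compact_bounded[OF v'] by blast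
  have vd: "vderiv v x = 0" if "x \<notin> {1/2..2}" for x
    using fourier_deriv(2)[OF smooth_has_vector_derivative[OF v'(1)] smooth_continuous[OF smooth_vderiv[OF v'(1)]] v'(2)] that by blast
  obtain V' where V': "V' \<ge> 0" "\<And>x. norm (vderiv v x) \<le> V'"
    using smooth_compact_bounded[OF smooth_vderiv[OF v'(1)] vd] by blast
  define h where "h t = complex_of_real (\<eta> t)" for t
  have h: "smooth h" unfolding h_def[abs_def] by (rule smooth_bump)
  have hz: "h t = 0" if "t \<notin> {-L..L}" for t
    unfolding h_def using that by (subst bump_zero) (auto simp: abs_if)
  have hd: "vderiv h x = 0" if "x \<notin> {-L..L}" for x
    using fourier_deriv(2)[OF smooth_has_vector_derivative[OF h] smooth_continuous[OF smooth_vderiv[OF h]] hz] that by blast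
  obtain B' where B': "B' \<ge> 0" "\<And>x. norm (vderiv h x) \<le> B'"
    using smooth_compact_bounded[OF smooth_vderiv[OF h] hd] by blast
  define D where "D = 2 * L * (V * B + (V' * B + V * B')) + 1"
  have nn: "0 \<le> V * B" "0 \<le> V' * B" "0 \<le> V * B'" using V V' B' B_ge by auto
  have D: "2 * L * (V * B) \<le> D" "2 * L * (V' * B + V * B') \<le> D"
  proof -
    have "0 \<le> 2 * L * (V * B)" "0 \<le> 2 * L * (V' * B + V * B')" using L nn by simp_all
    then show "2 * L * (V * B) \<le> D" "2 * L * (V' * B + V * B') \<le> D"
      unfolding D_def distrib_left[of "2 * L" "V * B" "V' * B + V * B'"] by linarith+
  qed
  show ?thesis
  proof (rule that[of D])
    have "0 \<le> 2 * L * (V * B + (V' * B + V * B'))" using nn L by simp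
    then show "D > 0" unfolding D_def by linarith
  next
    fix j :: int and l assume j: "j \<ge> 0" and l: "l = nat j div 2"
    define q where "q = (2::real) powi j"
    have q: "u l \<le> q" "q \<le> 2 * u l" using dyadic_scale[OF j] by (simp_all add: q_def l)
    then have qpos: "q > 0" using u_pos[of l] by linarith
    define c where "c = 3/2 * u l"
    define G where "G x = v (x / q) * complex_of_real (g l x)" for x
    have G_eq: "v (x / q) * \<psi> x = G x" for x
    proof (cases "x / q \<in> {1/2..2}")
      case True
      then have "q / 2 \<le> x" "x \<le> 2 * q" using qpos by (auto simp: field_simps)
      then have "\<psi> x = of_real (g l x)" using q by (intro \<psi>_block) auto
      then show ?thesis by (simp add: G_def)
    qed (simp add: G_def v')
    have block: "besov_block v j (regular_dist \<psi>) = fourier G"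
      using besov_block_regular[of v j \<psi>] v' by (simp add: G_eq flip: q_def)
    define I where "I = {c - L * w l..c + L * w l}"
    have Gz: "G x = 0" if "x \<notin> I" for x
      using bump_at_outside[OF w_pos] that by (simp add: G_def g_def c_def I_def)
    define G' where "G' x = v (x / q) * (of_real (a l / w l) * vderiv h ((x - c) / w l))
        + (of_real (1 / q) * vderiv v (x / q)) * of_real (g l x)" for x
    have dv: "((\<lambda>x. v (x / q)) has_vector_derivative of_real (1 / q) * vderiv v (x / q)) (at x)" for x
      using has_vector_derivative_affine[OF smooth_has_vector_derivative[OF v'(1)], of "1/q" 0 x] by simp
    have dg: "((\<lambda>x. complex_of_real (g l x)) has_vector_derivative (of_real (a l / w l) * vderiv h ((x - c) / w l))) (at x)" for x
    proof -
      have "((\<lambda>x. of_real (a l) * h (1 / w l * x + - c / w l)) has_vector_derivative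
          of_real (a l) * (of_real (1 / w l) * vderiv h (1 / w l * x + - c / w l))) (at x)"
        by (intro has_vector_derivative_mult_right has_vector_derivative_affine smooth_has_vector_derivative h)
      then show ?thesis by (simp add: g_def bump_at_def h_def c_def diff_divide_distrib)
    qed
    have dG: "(G has_vector_derivative G' x) (at x)" for x
      unfolding G_def G'_def by (intro has_vector_derivative_mult dv dg)
    have cv: "continuous_on UNIV (\<lambda>x. f (x / r + s))" if "smooth f" for f :: "real \<Rightarrow> complex" and r s :: real
      using smooth_continuous[OF smooth_affine[OF that, of "1/r" s]] by simp
    have cG: "continuous_on UNIV G"
      unfolding G_def using cv[OF v'(1), of q 0]
      by (intro continuous_intros continuous_g) simp
    have cG': "continuous_on UNIV G'"
      unfolding G'_def using cv[OF v'(1), of q 0] cv[OF smooth_vderiv[OF v'(1)], of q 0]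
        cv[OF smooth_vderiv[OF h], of "w l" "- c / w l"]
      by (intro continuous_intros continuous_g) (simp_all add: diff_divide_distrib)
    have gB: "norm (complex_of_real (g l x)) \<le> a l * B" for x
      using a_pos[of l] unfolding norm_of_real abs_of_nonneg[OF g_nonneg] by (simp add: g_def)
    have Gle: "norm (G x) \<le> V * (a l * B)" for x
      unfolding G_def norm_mult using gB V by (intro mult_mono) auto
    have G'le: "norm (G' x) \<le> a l * (V' * B + V * B') / w l" for x
    proof -
      have "norm (G' x) \<le> norm (v (x / q) * (of_real (a l / w l) * vderiv h ((x - c) / w l)))
          + norm ((of_real (1 / q) * vderiv v (x / q)) * complex_of_real (g l x))"
        unfolding G'_def by (rule norm_triangle_ineq)
      also have "\<dots> \<le> V * (a l / w l * B') + (1 / w l * V') * (a l * B)"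
      proof (rule add_mono)
        show "norm (v (x / q) * (of_real (a l / w l) * vderiv h ((x - c) / w l))) \<le> V * (a l / w l * B')"
          unfolding norm_mult using V B' a_pos[of l] w_pos[of l] by (intro mult_mono) (auto simp: norm_divide)
        have "w l \<le> q" using Lw_le(1,2)[of l] q u_pos[of l] by linarith
        then have "1 / q \<le> 1 / w l" using w_pos[of l] by (intro divide_left_mono) auto
        then show "norm ((of_real (1 / q) * vderiv v (x / q)) * complex_of_real (g l x)) \<le> (1 / w l * V') * (a l * B)"
          unfolding norm_mult using V' gB qpos w_pos[of l] by (intro mult_mono) (auto simp: norm_divide)
      qed
      also have "\<dots> = a l * (V' * B + V * B') / w l"
        unfolding divide_inverse by (simp add: algebra_simps)
      finally show ?thesis .
    qed
    have "in_Lp p (fourier G) \<and> (LBINT \<xi>. norm (fourier G \<xi>) powr p) \<le> (a l * w l * D) powr p * cauchy_mass / w l"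
    proof (intro conjI decay_Lp[where D = "a l * w l * D" and w = "w l" and m = 1])
      have aw: "0 < a l * w l" using a_pos w_pos by simp
      show "fourier G \<in> borel_measurable borel" "fourier G \<in> borel_measurable borel"
        by (intro fourier_measurable borel_measurable_continuous_onI cG)+
      show *: "norm (fourier G \<xi>) \<le> a l * w l * D" for \<xi>
      proof -
        have "norm (fourier G \<xi>) \<le> V * (a l * B) * ((c + L * w l) - (c - L * w l))"
          by (rule fourier_le[OF cG]) (use Gz Gle Lw_le in \<open>auto simp: I_def less_imp_le\<close>)
        also have "\<dots> = a l * w l * (2 * L * (V * B))" by simp
        also have "\<dots> \<le> a l * w l * D"
          using aw D by (intro mult_left_mono) auto
        finally show ?thesis .
      qed
      then show "norm (fourier G \<xi>) \<le> a l * w l * D" for \<xi> .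
      show **: "\<bar>w l * \<xi>\<bar> ^ 1 * norm (fourier G \<xi>) \<le> a l * w l * D" for \<xi>
      proof -
        have d: "fourier G' \<xi> = \<i> * of_real \<xi> * fourier G \<xi>" and z: "\<And>x. x \<notin> I \<Longrightarrow> G' x = 0"
          using fourier_deriv[OF dG cG', of "c - L * w l" "c + L * w l"] Gz unfolding I_def by blast+
        have "\<bar>w l * \<xi>\<bar> ^ 1 * norm (fourier G \<xi>) = w l * norm (fourier G' \<xi>)"
          using w_pos[of l] by (simp add: d norm_mult abs_mult)
        also have "\<dots> \<le> w l * (a l * (V' * B + V * B') / w l * ((c + L * w l) - (c - L * w l)))"
          by (intro mult_left_mono fourier_le[OF cG']) (use z G'le Lw_le w_pos[of l] in \<open>auto simp: I_def less_imp_le\<close>)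
        also have "\<dots> = a l * w l * (2 * L * (V' * B + V * B'))" using w_pos[of l] by simp
        also have "\<dots> \<le> a l * w l * D"
          using aw D by (intro mult_left_mono) auto
        finally show ?thesis .
      qed
      then show "\<bar>w l * \<xi>\<bar> ^ 1 * norm (fourier G \<xi>) \<le> a l * w l * D" for \<xi> .
    qed (use p w_pos in auto)
    then show "in_Lp p (besov_block v j (regular_dist \<psi>)) \<and>
      (LBINT \<xi>. norm (besov_block v j (regular_dist \<psi>) \<xi>) powr p) \<le> (a l * w l * D) powr p * cauchy_mass / w l"
      by (simp add: block)
  qed
qed

lemma aw_powr: "a l powr p * w l powr p = u l powr (- (2 + p * \<alpha> + p * \<beta>)) * w l"
  using w_pos[of l] unfolding a_powr mult.assoc by (simp flip: powr_add)

text \<open>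
  Block \<open>j\<close> contributes at most a constant times \<open>1 / u (j div 2)\<close> by the choice of \<open>a\<close>, hence at most
  \<open>C 2\<^sup>-\<^sup>j\<close>. Blocks with negative index do not meet the support of the symbol.
\<close>

lemma \<psi>_besov:
  assumes v: "dyadic_cutoff v"
  shows "regular_dist \<psi> \<in> besov_class v p (1 / p + \<alpha> + \<beta>)"
proof -
  note v' = dyadic_cutoff_props[OF v]
  define s where "s = 1 / p + \<alpha> + \<beta>"
  define r where "r = 1 + p * \<alpha> + p * \<beta>"
  have sp: "s * p = r" using p by (simp add: s_def r_def field_simps)
  obtain D where D: "D > 0" "\<And>j l. j \<ge> 0 \<Longrightarrow> l = nat j div 2 \<Longrightarrow> in_Lp p (besov_block v j (regular_dist \<psi>)) \<and>
      (LBINT \<xi>. norm (besov_block v j (regular_dist \<psi>) \<xi>) powr p) \<le> (a l * w l * D) powr p * cauchy_mass / w l"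
    using besov_block_bound[OF v] by blast
  define tm where "tm j = (2 powr (of_int j * s) * Lp_norm p (besov_block v j (regular_dist \<psi>))) powr p" for j
  define C where "C = 2 * 2 powr \<bar>r\<bar> * D powr p * cauchy_mass"
  have C: "C \<ge> 0" using cauchy_mass_nonneg by (simp add: C_def)
  have neg: "besov_block v j (regular_dist \<psi>) = (\<lambda>_. 0)" if j: "j < 0" for j
  proof -
    have "2 powi j \<le> (2::real) powi -1" using j by (intro power_int_increasing) auto
    then have q: "(2::real) powi j \<le> 1/2" "(0::real) < 2 powi j" by simp_all
    have "v (x / 2 powi j) * \<psi> x = 0" for x
    proof (cases "x / 2 powi j \<in> {1/2..2}")
      case True
      then have "x \<le> 2 * 2 powi j" using q(2) by (simp add: field_simps)
      then show ?thesis using q by (simp add: \<psi>_small)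
    qed (simp add: v')
    then have "(\<lambda>x. v (x / 2 powi j) * \<psi> x) = (\<lambda>_. 0)" by (rule ext)
    moreover have "besov_block v j (regular_dist \<psi>) = fourier (\<lambda>x. v (x / 2 powi j) * \<psi> x)"
      by (rule besov_block_regular) (use v' in auto)
    moreover have "fourier (\<lambda>_. 0) = (\<lambda>_. 0)" by (simp add: fourier_def fun_eq_iff)
    ultimately show ?thesis by (simp only:)
  qed
  have pos: "tm j \<le> C * (1/2) ^ nat j" if j: "j \<ge> 0" for j
  proof -
    define l where "l = nat j div 2"
    define q where "q = (2::real) powi j"
    have q: "u l \<le> q" "q \<le> 2 * u l" using dyadic_scale[OF j] by (simp_all add: l_def q_def)
    have qpos: "q > 0" using q u_pos[of l] by linarith
    have "2 powr - \<bar>r\<bar> * q powr r \<le> u l powr r"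
      using q by (intro powr_ge_scale qpos) auto
    then have qr: "q powr r \<le> 2 powr \<bar>r\<bar> * u l powr r"
      by (simp add: powr_minus field_simps)
    have "2 powr (of_int j * s * p) = q powr r"
      unfolding q_def by (simp add: powr_real_of_int'[symmetric] powr_powr sp mult.assoc)
    then have "tm j = q powr r * (LBINT \<xi>. norm (besov_block v j (regular_dist \<psi>) \<xi>) powr p)"
      unfolding tm_def using p by (subst Lp_norm_powr) auto
    also have "\<dots> \<le> (2 powr \<bar>r\<bar> * u l powr r) * ((a l * w l * D) powr p * cauchy_mass / w l)"
      using D(2)[OF j l_def] by (intro mult_mono qr) (auto intro!: integral_nonneg_AE)
    also have "(a l * w l * D) powr p * cauchy_mass / w l = u l powr (- (1 + r)) * (D powr p * cauchy_mass)"
    proof -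
      have "(a l * w l * D) powr p = a l powr p * w l powr p * D powr p"
        using a_pos[of l] w_pos[of l] D(1) by (simp add: powr_mult)
      moreover have rr: "- (1 + r) = - (2 + p * \<alpha> + p * \<beta>)" by (simp add: r_def)
      ultimately show ?thesis unfolding aw_powr rr using w_pos[of l] by simp
    qed
    also have "(2 powr \<bar>r\<bar> * u l powr r) * (u l powr (- (1 + r)) * (D powr p * cauchy_mass))
        = (u l powr r * u l powr (- (1 + r))) * (2 powr \<bar>r\<bar> * D powr p * cauchy_mass)"
      by (simp only: mult_ac)
    also have "u l powr r * u l powr (- (1 + r)) = 1 / u l"
      using u_pos[of l] by (simp flip: powr_add)
    also have "1 / u l * (2 powr \<bar>r\<bar> * D powr p * cauchy_mass) \<le> 2 / q * (2 powr \<bar>r\<bar> * D powr p * cauchy_mass)"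
      using q qpos u_pos[of l] cauchy_mass_nonneg by (intro mult_right_mono) (auto simp: field_simps)
    also have "\<dots> = C * (1/2) ^ nat j"
      using j by (simp add: C_def q_def power_int_def power_one_over)
    finally show ?thesis .
  qed
  have "tm summable_on UNIV \<longleftrightarrow> tm summable_on {0..}"
    by (rule summable_on_cong_neutral) (use neg p in \<open>auto simp: tm_def Lp_norm_def\<close>)
  also have "{0..} = int ` UNIV"
    by (auto intro: image_eqI[of _ int "nat _"])
  also have "tm summable_on int ` UNIV \<longleftrightarrow> (tm \<circ> int) summable_on UNIV"
    by (rule summable_on_reindex) simp
  finally have "tm summable_on UNIV \<longleftrightarrow> (tm \<circ> int) summable_on UNIV" .
  moreover have "(tm \<circ> int) summable_on UNIV"
  proof (rule norm_summable_imp_summable_on, rule summable_comparison_test'[where N = 0])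
    show "summable (\<lambda>n. C * (1/2) ^ n)" by (intro summable_mult summable_geometric) simp
    show "norm (norm ((tm \<circ> int) n)) \<le> C * (1/2) ^ n" for n
      using pos[of "int n"] by (simp add: tm_def)
  qed
  ultimately have "tm summable_on UNIV" by simp
  moreover have "in_Lp p (besov_block v j (regular_dist \<psi>))" for j
    using D(2)[of j] neg[of j] p by (cases "j \<ge> 0") (auto simp: in_Lp_def)
  ultimately show ?thesis
    using distribution_regular_dist[OF \<psi>_locally_integrable]
    by (simp add: besov_class_def tm_def[abs_def] s_def)
qed

text \<open>
  The case distinction in the hypothesis on \<open>\<gamma>\<close> and \<open>\<delta>\<close> says which boundary is used: the points \<open>z i\<close> at distance
  of order \<open>(w l) i\<close> from \<open>0\<close> are taken in the variable that carries the exponent \<open>\<gamma>\<close>, their mirror images \<open>c - z i\<close>, which are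
  comparable to \<open>u l\<close>, in the other one.
\<close>

lemma sing_val_lacunary_ge:
  assumes T: "bounded_op T"
    and agree: "\<And>f. f \<in> test_functions \<Longrightarrow> AE s in Rplus. T f s = hankel \<alpha> \<beta> (regular_dist \<psi>) f s"
    and \<gamma>: "(\<gamma> = \<alpha> \<and> \<delta> = \<beta>) \<or> (\<gamma> = \<beta> \<and> \<delta> = \<alpha>)" "\<gamma> \<le> 0"
    and j: "j < M l"
  shows "(6 * L) powr \<gamma> * 2 powr (- \<bar>\<delta>\<bar>) / (B * sqrt (2 * L)) *
      ((w l * (real j + 1)) powr \<gamma> * u l powr \<delta> * (a l * w l)) \<le> sing_val T j"
proof -
  define c where "c = 3/2 * u l"
  define z where "z i = 5 * (L * w l) * (real i + 1)" for i :: nat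
  define \<kappa> where "\<kappa> = (6 * (L * w l) * (real j + 1)) powr \<gamma> * (2 powr (- \<bar>\<delta>\<bar>) * u l powr \<delta>)"
  note Lw = Lw_le[of l]
  have "0 < 6 * (L * w l) * (real j + 1)" using Lw(3) mult_pos_pos[of "6 * (L * w l)" "real j + 1"] by linarith
  then have "6 * (L * w l) * (real j + 1) \<noteq> 0" by linarith
  then have "0 < (6 * (L * w l) * (real j + 1)) powr \<gamma>" by (simp only: powr_gt_zero) simp
  moreover have "0 < 2 powr (- \<bar>\<delta>\<bar>) * u l powr \<delta>" using u_pos[of l] by simp
  ultimately have \<kappa>: "\<kappa> > 0" unfolding \<kappa>_def by (rule mult_pos_pos)
  have z_ge: "5 * (L * w l) \<le> z i" for i
  proof -
    have "5 * (L * w l) * 1 \<le> 5 * (L * w l) * (real i + 1)" using Lw by (intro mult_left_mono) auto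
    then show ?thesis by (simp add: z_def)
  qed
  have z_le: "z i \<le> u l / 8" if "i \<le> j" for i
  proof -
    have "L * w l * (real i + 1) \<le> L * w l * M l" using that j Lw by (intro mult_left_mono) auto
    then show ?thesis using w_u[of l] by (simp add: z_def)
  qed
  have sep: "5 * (L * w l) \<le> \<bar>z i - z k\<bar>" if "i \<noteq> k" for i k
  proof -
    have "1 \<le> \<bar>real i - real k\<bar>" using that by linarith
    then have "5 * (L * w l) * 1 \<le> 5 * (L * w l) * \<bar>real i - real k\<bar>" using Lw by (intro mult_left_mono) auto
    also have "\<dots> = \<bar>5 * (L * w l) * (real i - real k)\<bar>" using abs_of_pos[OF Lw(3)] by (simp only: abs_mult abs_numeral)
    also have "5 * (L * w l) * (real i - real k) = z i - z k" by (simp add: z_def algebra_simps)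
    finally show ?thesis by simp
  qed
  \<comment> \<open>\<open>z i + w l / 2 \<le> 6 (L w l) (i + 1)\<close> because \<open>w l \<le> L w l\<close>, and the weight decreases with the distance from the boundary.\<close>
  have near: "(6 * (L * w l) * (real j + 1)) powr \<gamma> \<le> s powr \<gamma>" if i: "i \<le> j" and s: "\<bar>s - z i\<bar> \<le> w l / 2" for s i
  proof -
    have s0: "0 < s" using s z_ge[of i] Lw by linarith
    have "L * w l * 1 \<le> L * w l * (real i + 1)" using Lw by (intro mult_left_mono) auto
    moreover have "z i = 5 * (L * w l * (real i + 1))" by (simp add: z_def)
    ultimately have "s \<le> 6 * (L * w l * (real i + 1))" using s Lw(2) by linarith
    also have "\<dots> \<le> 6 * (L * w l * (real j + 1))" using i Lw by (intro mult_left_mono) auto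
    finally show ?thesis using s0 \<gamma>(2) by (intro powr_mono2') (auto simp: mult_ac)
  qed
  have far: "2 powr (- \<bar>\<delta>\<bar>) * u l powr \<delta> \<le> t powr \<delta>" if "i \<le> j" "\<bar>t - (c - z i)\<bar> \<le> w l / 2" for t i
    using that z_le[of i] z_ge[of i] Lw u_pos[of l] unfolding c_def by (intro powr_ge_scale u_pos; linarith)
  have weight: "\<kappa> \<le> s powr \<gamma> * t powr \<delta>" if "i \<le> j" "\<bar>s - z i\<bar> \<le> w l / 2" "\<bar>t - (c - z i)\<bar> \<le> w l / 2" for s t i
    unfolding \<kappa>_def using near[OF that(1,2)] far[OF that(1,3)] by (intro mult_mono) auto
  have kernel: "\<psi> t = of_real (a l * bump_at c (w l) t)" if "t = c + (z i - z k) + s" "i \<le> j" "k \<le> j" "\<bar>s\<bar> \<le> 2 * (L * w l)" for t i k s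
  proof -
    have "u l / 2 \<le> t" "t \<le> 4 * u l"
      using that z_le[of i] z_le[of k] z_ge[of i] z_ge[of k] Lw u_pos[of l] unfolding c_def by linarith+
    then show ?thesis using \<psi>_block[of l t] by (simp add: g_def c_def)
  qed
  have far_pos: "5 * (L * w l) \<le> c - z i" if "i \<le> j" for i
    using z_le[OF that] Lw u_pos[of l] unfolding c_def by linarith
  have "\<kappa> * a l * w l / (B * sqrt (2 * L)) \<le> sing_val T j"
    using \<gamma>(1)
  proof
    assume eq: "\<gamma> = \<alpha> \<and> \<delta> = \<beta>"
    show ?thesis
    proof (rule sing_val_narrow_ge[OF T agree w_pos a_pos \<kappa>, where x = z and y = "\<lambda>i. c - z i"])
      show "\<psi> (z i + (c - z k) + s) = of_real (a l * bump_at c (w l) (z i + (c - z k) + s))"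
        if "i \<le> j" "k \<le> j" "\<bar>s\<bar> \<le> 2 * (L * w l)" for i k s
        by (rule kernel[OF _ that]) simp
      show "\<kappa> \<le> s powr \<alpha> * t powr \<beta>" if "i \<le> j" "\<bar>s - z i\<bar> \<le> w l / 2" "\<bar>t - (c - z i)\<bar> \<le> w l / 2" for i s t
        using weight[OF that] eq by simp
    qed (use sep z_ge far_pos in auto)
  next
    assume eq: "\<gamma> = \<beta> \<and> \<delta> = \<alpha>"
    show ?thesis
    proof (rule sing_val_narrow_ge[OF T agree w_pos a_pos \<kappa>, where x = "\<lambda>i. c - z i" and y = z])
      show "\<psi> (c - z i + z k + s) = of_real (a l * bump_at c (w l) (c - z i + z k + s))"
        if "i \<le> j" "k \<le> j" "\<bar>s\<bar> \<le> 2 * (L * w l)" for i k s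
        by (rule kernel[OF _ that(2,1,3)]) simp
      show "\<kappa> \<le> s powr \<alpha> * t powr \<beta>" if "i \<le> j" "\<bar>s - (c - z i)\<bar> \<le> w l / 2" "\<bar>t - z i\<bar> \<le> w l / 2" for i s t
        using weight[OF that(1,3,2)] eq by (simp add: mult.commute)
      show "5 * (L * w l) \<le> \<bar>c - z i - (c - z k)\<bar>" if "i \<noteq> k" for i k
        using sep[OF that] by (simp add: abs_minus_commute)
    qed (use z_ge far_pos in auto)
  qed
  also have "\<kappa> * a l * w l / (B * sqrt (2 * L)) = (6 * L) powr \<gamma> * 2 powr (- \<bar>\<delta>\<bar>) / (B * sqrt (2 * L)) *
      ((w l * (real j + 1)) powr \<gamma> * u l powr \<delta> * (a l * w l))"
  proof -
    have "(6 * (L * w l) * (real j + 1)) powr \<gamma> = ((6 * L) * (w l * (real j + 1))) powr \<gamma>" by (simp add: mult_ac)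
    also have "\<dots> = (6 * L) powr \<gamma> * (w l * (real j + 1)) powr \<gamma>"
      by (rule powr_mult)
    finally show ?thesis by (simp add: \<kappa>_def)
  qed
  finally show ?thesis .
qed

text \<open>
  With \<open>X = j + 1\<close> the \<open>p\<close>-th power of the bound for \<open>sing_val T j\<close> is a constant times
  \<open>X\<^sup>\<gamma>\<^sup>p (w l / u l)\<^sup>1\<^sup>+\<^sup>\<gamma>\<^sup>p / u l\<close>. Since \<open>w l / u l \<le> 1 / X\<close> and \<open>1 + \<gamma> p \<le> 0\<close>, this is at least
  \<open>1 / (u l X)\<close>. Up to the constant, the sum over \<open>j < M l\<close> is at least \<open>harm (M l) / u l \<ge> 4\<^sup>l\<close>.
\<close>

lemma \<psi>_not_schatten:
  assumes min: "min \<alpha> \<beta> \<le> - 1 / p"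
  shows "\<not> hankel_in_schatten \<alpha> \<beta> (regular_dist \<psi>) p"
proof
  assume "hankel_in_schatten \<alpha> \<beta> (regular_dist \<psi>) p"
  then obtain T where T: "bounded_op T" "T \<in> schatten p"
    and agree: "\<And>f. f \<in> test_functions \<Longrightarrow> AE s in Rplus. T f s = hankel \<alpha> \<beta> (regular_dist \<psi>) f s"
    by (auto simp: hankel_in_schatten_def)
  have sm: "summable (\<lambda>j. sing_val T j powr p)" using T(2) by (simp add: schatten_def)
  define \<gamma> where "\<gamma> = min \<alpha> \<beta>"
  define \<delta> where "\<delta> = max \<alpha> \<beta>"
  have \<gamma>\<delta>: "(\<gamma> = \<alpha> \<and> \<delta> = \<beta>) \<or> (\<gamma> = \<beta> \<and> \<delta> = \<alpha>)" by (auto simp: \<gamma>_def \<delta>_def min_def max_def)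
  have \<gamma>: "\<gamma> \<le> - 1 / p" using min by (simp add: \<gamma>_def)
  have gp: "\<gamma> * p + 1 \<le> 0" using \<gamma> p by (simp add: field_simps)
  have "- 1 / p \<le> 0" using p by simp
  then have \<gamma>0: "\<gamma> \<le> 0" using \<gamma> by linarith
  define A where "A = (6 * L) powr \<gamma> * 2 powr (- \<bar>\<delta>\<bar>) / (B * sqrt (2 * L))"
  have A: "A > 0" using L B_ge by (simp add: A_def)
  have tail: "A powr p / u l * inverse (real (Suc j)) \<le> sing_val T j powr p" if j: "j < M l" for j l
  proof -
    define X where "X = real j + 1"
    have X: "X > 0" by (simp add: X_def)
    have pos: "0 < u l" "0 < w l" "0 < a l" by (rule u_pos w_pos a_pos)+
    have wX: "w l \<le> u l / X"
    proof -
      have "w l * X \<le> w l * M l" using j pos by (intro mult_left_mono) (auto simp: X_def)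
      also have "\<dots> \<le> L * w l * M l" using Lw_le(2)[of l] by (intro mult_right_mono) auto
      also have "\<dots> \<le> u l" using w_u[of l] pos(1) by linarith
      finally show ?thesis using X by (simp add: field_simps)
    qed
    define E where "E = (w l * X) powr \<gamma> * u l powr \<delta> * (a l * w l)"
    have "A * E \<le> sing_val T j"
      using sing_val_lacunary_ge[OF T(1) agree \<gamma>\<delta> \<gamma>0 j] by (simp add: A_def E_def X_def add.commute)
    then have "(A * E) powr p \<le> sing_val T j powr p"
      using A pos X p by (intro powr_mono2) (auto simp: E_def)
    moreover have "E powr p \<ge> 1 / (u l * X)"
    proof -
      have "E powr p = (w l * X) powr (\<gamma> * p) * u l powr (\<delta> * p) * (a l powr p * w l powr p)"
        using pos X by (simp add: E_def powr_mult powr_powr)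
      also have "\<dots> = (w l powr (\<gamma> * p) * w l) * X powr (\<gamma> * p) * (u l powr (\<delta> * p) * u l powr (- (2 + p * \<alpha> + p * \<beta>)))"
        unfolding aw_powr using pos X by (simp add: powr_mult)
      also have "w l powr (\<gamma> * p) * w l = w l powr (\<gamma> * p + 1)"
        using pos by (simp add: powr_add)
      also have "u l powr (\<delta> * p) * u l powr (- (2 + p * \<alpha> + p * \<beta>)) = u l powr (- 2 - \<gamma> * p)"
      proof -
        have "\<delta> * p + - (2 + p * \<alpha> + p * \<beta>) = - 2 - \<gamma> * p" using \<gamma>\<delta> by (auto simp: algebra_simps)
        then show ?thesis by (simp only: powr_add[symmetric])
      qed
      finally have E: "E powr p = w l powr (\<gamma> * p + 1) * X powr (\<gamma> * p) * u l powr (- 2 - \<gamma> * p)" .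
      have "(u l / X) powr (\<gamma> * p + 1) \<le> w l powr (\<gamma> * p + 1)"
        using wX pos gp by (intro powr_mono2') auto
      then have "(u l / X) powr (\<gamma> * p + 1) * X powr (\<gamma> * p) * u l powr (- 2 - \<gamma> * p) \<le> E powr p"
        unfolding E by (intro mult_right_mono) auto
      also have "(u l / X) powr (\<gamma> * p + 1) * X powr (\<gamma> * p) * u l powr (- 2 - \<gamma> * p)
          = (u l powr (\<gamma> * p + 1) * u l powr (- 2 - \<gamma> * p)) * (X powr (\<gamma> * p) / X powr (\<gamma> * p + 1))"
        using pos X by (simp add: powr_divide)
      also have "u l powr (\<gamma> * p + 1) * u l powr (- 2 - \<gamma> * p) = 1 / u l"
        using pos by (simp flip: powr_add)
      also have "X powr (\<gamma> * p) / X powr (\<gamma> * p + 1) = 1 / X"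
        using X by (simp flip: powr_diff)
      finally show ?thesis by simp
    qed
    then have "A powr p * (1 / (u l * X)) \<le> A powr p * E powr p" by (intro mult_left_mono) auto
    moreover have "A powr p * E powr p = (A * E) powr p"
      using A pos X by (simp add: E_def powr_mult)
    ultimately show ?thesis by (simp add: X_def divide_inverse mult_ac add_ac)
  qed
  have bound: "A powr p * 4 ^ l \<le> suminf (\<lambda>j. sing_val T j powr p)" for l
  proof -
    have "A powr p * 4 ^ l = A powr p / u l * 16 ^ l"
      by (simp add: u_def field_simps flip: power_mult_distrib)
    also have "\<dots> \<le> A powr p / u l * harm (M l)"
      using harm_M u_pos[of l] by (intro mult_left_mono) auto
    also have "\<dots> = (\<Sum>j<M l. A powr p / u l * inverse (real (Suc j)))"
      by (simp add: harm_altdef sum_distrib_left)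
    also have "\<dots> \<le> (\<Sum>j<M l. sing_val T j powr p)"
      by (intro sum_mono tail) auto
    also have "\<dots> \<le> suminf (\<lambda>j. sing_val T j powr p)"
      by (intro sum_le_suminf sm) auto
    finally show ?thesis .
  qed
  obtain l where "suminf (\<lambda>j. sing_val T j powr p) / A powr p < 4 ^ l"
    using real_arch_pow[of 4] by auto
  then show False using bound[of l] A by (simp add: field_simps)
qed

end

section \<open>Failure of the Schatten class criterion\<close>

theorem theorem3p1:
  fixes \<alpha> \<beta> p :: real and v :: "real \<Rightarrow> complex"
  assumes "dyadic_cutoff v"
    and "0 < p"
    and "min \<alpha> \<beta> \<le> max (- 1 / 2) (- 1 / p)"
  shows "\<exists>\<psi>. locally_integrable \<psi> \<and>
           regular_dist \<psi> \<in> besov_class v p (1 / p + \<alpha> + \<beta>) \<and>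
           \<not> hankel_in_schatten \<alpha> \<beta> (regular_dist \<psi>) p"
proof -
  obtain \<eta> :: "real \<Rightarrow> real" and L B :: real where
    "L \<ge> 1" "smooth (\<lambda>t. of_real (\<eta> t))" "\<And>t. 0 \<le> \<eta> t" "\<And>t. \<eta> t \<le> B"
    "\<And>t. \<bar>t\<bar> \<le> 1 \<Longrightarrow> 1 \<le> \<eta> t" "\<And>t. L < \<bar>t\<bar> \<Longrightarrow> \<eta> t = 0"
    using dyadic_cutoff_bump[OF assms(1)] by metis
  then interpret bump \<eta> L B by unfold_locales
  show ?thesis
  proof (cases "p \<le> 2")
    case True
    then have "- 1 / p \<le> - 1 / 2" using assms(2) by (simp add: field_simps)
    then have "\<alpha> \<le> - 1/2 \<or> \<beta> \<le> - 1/2" using assms(3) by (auto simp: min_def max_def split: if_splits)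
    then have "\<not> hankel_in_schatten \<alpha> \<beta> (regular_dist wide_bump) p"
      using wide_bump_unbounded_left wide_bump_unbounded_right
      unfolding hankel_in_schatten_def by blast
    then show ?thesis
      using wide_bump_locally_integrable wide_bump_besov[OF assms(1,2)] by blast
  next
    case False
    have "\<exists>n. 1 \<le> n \<and> (16::real) ^ l \<le> harm n" for l
    proof -
      have "eventually (\<lambda>n. 1 \<le> n \<and> (16::real) ^ l \<le> harm n) sequentially"
        using harm_at_top[unfolded filterlim_at_top] eventually_ge_at_top by (intro eventually_conj) auto
      then show ?thesis by (auto simp: eventually_sequentially)
    qed
    then obtain M where M: "\<And>l. 1 \<le> M l" "\<And>l. (16::real) ^ l \<le> harm (M l)" by metis
    interpret lacunary_bumps \<eta> L B M \<alpha> \<beta> p by unfold_locales (use False M in auto)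
    have "- 1 / 2 \<le> - 1 / p" using False by (simp add: field_simps)
    then have "min \<alpha> \<beta> \<le> - 1 / p" using assms(3) by simp
    then show ?thesis
      using \<psi>_locally_integrable \<psi>_besov[OF assms(1)] \<psi>_not_schatten by blast
  qed
qed

end
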